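(* Let $n\geq 3$ be an integer, let $X$ be a random vector in $\mathbb{R}^n$ with the standard normal distribution, and let $1<p<3/2$, $0\leq r\leq 2$. (1) There exist positive universal constants $c,C$ (independent of $n,r,p$) such that $$\mathbb{M}\sum_{i=1}^{n}i^{-2r}X_{[i]}^{2(p-1)}\leq\begin{cases}Cn^{1-2r}(\ln n)^p\left[1+(1-2r)\ln n\right]^{-p}, & 0\leq r\leq 1/2,\\ C(\ln n)^p\left[1+(2r-1)\ln n\right]^{-1}, & 1/2\leq r\leq 2,\end{cases}$$ and the reverse inequality holds with $C$ replaced by $c$. (2) There exist positive universal constants $c,C$, positive constants $c_{r,p},C_{r,p}$ and $n_{r,p}$ depending only on $r,p$, and $t_{n,r,p}>0$ depending only on $n,r,p$, such that for all $t>t_{n,r,p}$, $$\mathbb{P}\left\{\sum_{i=1}^{n}i^{-2r}X_{[i]}^{2(p-1)}>t\right\}\leq\begin{cases}2\exp\left(-c_{r,p}\left[1+n^{(2-2r-p)/(p-1)}\right]^{-1}t^{1/(p-1)}\right), & p\neq 2-2r,\ n>n_{r,p},\\ 2\exp\left(-(\ln n)^{-(2-p)/(p-1)}(ct)^{1/(p-1)}\right), & p=2-2r,\end{cases}$$ and the reverse inequality holds with $c$ and $c_{r,p}$ replaced by $C$ and $C_{r,p}$ respectively.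
   Context: For $x\in\mathbb{R}^n$, $(x_{[i]})_{i=1}^n$ denotes the non-increasing rearrangement of $(|x_i|)_{i=1}^n$. $\mathbb{M}$ denotes the median of a random variable. The standard normal distribution on $\mathbb{R}^n$ is that of a vector with i.i.d. $N(0,1)$ coordinates. *)

theory Defs
  imports "HOL-Probability.Probability"
begin

text \<open>
  Since the dimension \<open>n\<close> is quantified inside the statement, a vector of \<open>\<real>\<^sup>n\<close> is a function
  \<open>nat \<Rightarrow> real\<close> of which only the values at the indices \<open>1, \<dots>, n\<close> matter, and a random vector on
  \<open>M\<close> is given by its coordinates \<open>X 1, \<dots>, X n\<close>.
\<close>

definition std_normal_vector :: "'a measure \<Rightarrow> nat \<Rightarrow> (nat \<Rightarrow> 'a \<Rightarrow> real) \<Rightarrow> bool" where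
  "std_normal_vector M n X \<longleftrightarrow>
     prob_space M \<and>
     prob_space.indep_vars M (\<lambda>_. borel) X {1..n} \<and>
     (\<forall>i\<in>{1..n}. distributed M lborel (X i) (\<lambda>x. ennreal (std_normal_density x)))"

text \<open>Indexed from 1 in both arguments; \<open>rearr n x i\<close> is only meaningful for \<open>1 \<le> i \<le> n\<close>.\<close>

definition rearr :: "nat \<Rightarrow> (nat \<Rightarrow> real) \<Rightarrow> nat \<Rightarrow> real" where
  "rearr n x i = rev (sort (map (\<lambda>j. \<bar>x j\<bar>) [1..<Suc n])) ! (i - 1)"

text \<open>
  A random variable may have several medians; statements about the median are made for each of them.
\<close>

definition is_median :: "'a measure \<Rightarrow> ('a \<Rightarrow> real) \<Rightarrow> real \<Rightarrow> bool" where
  "is_median M Y m \<longleftrightarrow>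
     measure M {\<omega> \<in> space M. Y \<omega> \<le> m} \<ge> 1 / 2 \<and> measure M {\<omega> \<in> space M. Y \<omega> \<ge> m} \<ge> 1 / 2"

definition rearr_sum :: "nat \<Rightarrow> real \<Rightarrow> real \<Rightarrow> (nat \<Rightarrow> real) \<Rightarrow> real" where
  "rearr_sum n r p x = (\<Sum>i = 1..n. real i powr (- 2 * r) * rearr n x i powr (2 * (p - 1)))"

end

theory Submission
  imports Defs
begin

text \<open>
  Write \<open>S\<close> for the rearranged sum, \<open>a = 1 - 2 * r\<close> and \<open>L = ln n\<close>.

  The median. An order statistic of a Gaussian vector satisfies \<open>X\<^bsub>[i]\<^esub>\<^sup>2 \<approx> ln (n / i)\<close>, so the median of
  \<open>S\<close> should be of the order of the sum of \<open>i powr (a - 1) * (1 + ln (n / i)) powr (p - 1)\<close>. From above this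
  holds simultaneously for all \<open>i\<close>, because every order statistic is controlled by the single
  variable \<open>(\<Sum>j. exp (X\<^sub>j\<^sup>2 / 4)) / n\<close> (\<open>rearr_square_le\<close>), whose expectation is \<open>sqrt 2\<close>. From below a
  single order statistic \<open>X\<^bsub>[J]\<^esub>\<close> suffices (\<open>rearr_sum_ge\<close>), with \<open>J = n * exp (- \<kappa>)\<close> chosen so that the
  indices up to \<open>J\<close> carry a fixed proportion of the sum; \<open>X\<^bsub>[J]\<^esub>\<close> is not much smaller than \<open>sqrt \<kappa>\<close> because
  the number of exceedances of a level is a sum of independent indicators (\<open>prob_rearr_less\<close>). What remains
  is elementary: under the weights \<open>i powr (a - 1)\<close>, the effective range of \<open>ln (n / i)\<close> is
  \<open>min L (1 / a) \<approx> L / (1 + a * L)\<close> if \<open>a \<ge> 0\<close> (\<open>log_sum_le_nonneg\<close>); if \<open>a \<le> 0\<close>, the logarithm is of the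
  order of \<open>L\<close> and the weights sum to about \<open>L / (1 + \<bar>a\<bar> * L)\<close> (\<open>log_sum_le_nonpos\<close>).

  The tail. For a fixed dimension and large \<open>t\<close>, the probability of \<open>S > t\<close> is governed by the point
  closest to the origin in this region, that is by the maximum of \<open>S\<close> over the unit sphere. By
  Hoelder's inequality the maximum is the power \<open>2 - p\<close> of the sum of \<open>i powr (- \<beta>)\<close>, where
  \<open>\<beta> = 2 * r / (2 - p)\<close>, and it is attained at a vector with decreasing coordinates. The upper bound follows
  from the chi-square tail, the lower bound from the probability of the box above a multiple of the
  extremal vector (\<open>prob_rearr_sum_greater_bounds\<close>). The critical relation \<open>p = 2 - 2 * r\<close> says exactly
  that \<open>\<beta> = 1\<close>, where the sum of the weights changes from a power of \<open>n\<close> to a bounded quantity through a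
  logarithm.
\<close>

section \<open>Order statistics and counting\<close>

lemma sorted_nth_ge_iff:
  fixes xs :: "'b :: linorder list"
  assumes "sorted_wrt (\<ge>) xs" "k < length xs"
  shows "c \<le> xs ! k \<longleftrightarrow> k < length (filter (\<lambda>y. c \<le> y) xs)"
  using assms
proof (induction xs arbitrary: k)
  case (Cons a xs)
  show ?case
  proof (cases k)
    case 0
    have "filter (\<lambda>y. c \<le> y) xs = []" if "\<not> c \<le> a"
      using Cons.prems(1) that by (auto simp: filter_empty_conv)
    then show ?thesis using 0 by auto
  next
    case (Suc j)
    have "\<not> c \<le> xs ! j" if "\<not> c \<le> a"
      using Cons.prems Suc that by (auto dest!: nth_mem)
    moreover have "filter (\<lambda>y. c \<le> y) xs = []" if "\<not> c \<le> a"
      using Cons.prems(1) that by (auto simp: filter_empty_conv)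
    ultimately show ?thesis using Cons Suc by auto
  qed
qed simp

text \<open>
  This turns every question about order statistics into one about counts of exceedances,
  which are sums of independent indicators in the random setting.
\<close>
lemma rearr_ge_iff:
  assumes "1 \<le> i" "i \<le> n"
  shows "c \<le> rearr n x i \<longleftrightarrow> i \<le> card {j \<in> {1..n}. c \<le> \<bar>x j\<bar>}"
proof -
  define xs where "xs = map (\<lambda>j. \<bar>x j\<bar>) [1..<Suc n]"
  have "sorted_wrt (\<ge>) (rev (sort xs))" by (simp add: sorted_wrt_rev)
  moreover have "i - 1 < length (rev (sort xs))" using assms by (simp add: xs_def)
  ultimately have "c \<le> rearr n x i \<longleftrightarrow> i - 1 < length (filter (\<lambda>y. c \<le> y) (rev (sort xs)))"
    unfolding rearr_def xs_def[symmetric] by (rule sorted_nth_ge_iff)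
  also have "length (filter (\<lambda>y. c \<le> y) (rev (sort xs))) = length (filter (\<lambda>y. c \<le> y) xs)"
    by (metis mset_filter mset_rev mset_sort size_mset)
  also have "\<dots> = length (filter (\<lambda>j. c \<le> \<bar>x j\<bar>) [1..<Suc n])"
    by (simp add: xs_def filter_map comp_def del: upt_Suc)
  also have "\<dots> = card {j \<in> {1..n}. c \<le> \<bar>x j\<bar>}"
    by (subst distinct_card[symmetric]) (auto intro!: arg_cong[where f=card] simp del: upt_Suc)
  finally show ?thesis using assms by auto
qed

lemma sum_rearr:
  "(\<Sum>i=1..n. f (rearr n x i)) = (\<Sum>j=1..n. f \<bar>x j\<bar> :: real)"
proof -
  define xs where "xs = map (\<lambda>j. \<bar>x j\<bar>) [1..<Suc n]"
  have "(\<Sum>i=1..n. f (rearr n x i)) = (\<Sum>k<n. f (rev (sort xs) ! k))"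
    by (rule sum.reindex_bij_witness[of _ Suc "\<lambda>i. i - 1"])
      (auto simp: rearr_def xs_def simp del: upt_Suc)
  also have "\<dots> = sum_list (map f (rev (sort xs)))"
    by (simp add: sum_list_sum_nth atLeast0LessThan xs_def del: upt_Suc)
  also have "\<dots> = sum_list (map f xs)"
    by (metis mset_map mset_rev mset_sort sum_mset_sum_list)
  also have "\<dots> = (\<Sum>j=1..n. f \<bar>x j\<bar>)"
    by (simp add: xs_def interv_sum_list_conv_sum_set_nat comp_def atLeastLessThanSuc_atLeastAtMost del: upt_Suc)
  finally show ?thesis .
qed

lemma rearr_nonneg:
  assumes "1 \<le> i" "i \<le> n"
  shows "0 \<le> rearr n x i"
proof -
  have "{j \<in> {1..n}. 0 \<le> \<bar>x j\<bar>} = {1..n}" by auto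
  then show ?thesis using assms by (simp only: rearr_ge_iff) simp
qed

lemma abs_le_rearr_1:
  assumes "j \<in> {1..n}"
  shows "\<bar>x j\<bar> \<le> rearr n x 1"
proof -
  have "card {k \<in> {1..n}. \<bar>x j\<bar> \<le> \<bar>x k\<bar>} \<noteq> 0" using assms by (auto simp: card_eq_0_iff)
  then have "1 \<le> card {k \<in> {1..n}. \<bar>x j\<bar> \<le> \<bar>x k\<bar>}" by linarith
  moreover have "1 \<le> n" using assms by simp
  ultimately show ?thesis by (simp only: rearr_ge_iff order_refl)
qed

lemma rearr_antimono:
  assumes "1 \<le> i" "i \<le> j" "j \<le> n"
  shows "rearr n x j \<le> rearr n x i"
  using rearr_ge_iff[of i n "rearr n x j" x] rearr_ge_iff[of j n "rearr n x j" x] assms by auto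

text \<open>
  At least \<open>i\<close> of the summands on the right are as large as the \<open>i\<close>-th order statistic.
\<close>
lemma mult_rearr_le_sum:
  fixes f :: "real \<Rightarrow> real"
  assumes i: "1 \<le> i" "i \<le> n" and f: "\<And>u. 0 \<le> f u" "mono_on {0..} f"
  shows "real i * f (rearr n x i) \<le> (\<Sum>j=1..n. f \<bar>x j\<bar>)"
proof -
  let ?c = "rearr n x i" and ?A = "{j \<in> {1..n}. rearr n x i \<le> \<bar>x j\<bar>}"
  have "i \<le> card ?A" using rearr_ge_iff[OF i, of ?c x] by simp
  then have "real i * f ?c \<le> real (card ?A) * f ?c" using f(1) by (intro mult_right_mono) auto
  also have "\<dots> = (\<Sum>j\<in>?A. f ?c)" by simp
  also have "\<dots> \<le> (\<Sum>j\<in>?A. f \<bar>x j\<bar>)"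
    using rearr_nonneg[OF i] by (intro sum_mono mono_onD[OF f(2)]) auto
  also have "\<dots> \<le> (\<Sum>j=1..n. f \<bar>x j\<bar>)" using f(1) by (intro sum_mono2) auto
  finally show ?thesis .
qed

lemma antimono_bound_le_rearr:
  assumes "\<And>j. j \<in> {1..n} \<Longrightarrow> u j \<le> \<bar>x j\<bar>" "1 \<le> i" "i \<le> n"
    "\<And>j. 1 \<le> j \<Longrightarrow> j \<le> i \<Longrightarrow> u i \<le> u j"
  shows "u i \<le> rearr n x i"
proof -
  have "u i \<le> \<bar>x j\<bar>" if "1 \<le> j" "j \<le> i" for j
    using assms(1)[of j] assms(3) assms(4)[OF that] that by auto
  then have "{1..i} \<subseteq> {j \<in> {1..n}. u i \<le> \<bar>x j\<bar>}" using assms(3) by auto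
  then have "card {1..i} \<le> card {j \<in> {1..n}. u i \<le> \<bar>x j\<bar>}" by (intro card_mono) auto
  then show ?thesis using assms by (subst rearr_ge_iff) auto
qed

text \<open>
  Markov's inequality for the counting measure on the coordinates, after taking logarithms.
  A single random quantity, the empirical exponential moment, controls all
  order statistics at once, which avoids any union bound over \<open>i\<close>.
\<close>
lemma rearr_square_le:
  assumes i: "1 \<le> i" "i \<le> n"
  shows "(rearr n x i)\<^sup>2 \<le> 4 * (ln (real n / real i) + (\<Sum>j=1..n. exp ((x j)\<^sup>2 / 4)) / real n)"
proof -
  let ?y = "(rearr n x i)\<^sup>2 / 4" and ?W = "(\<Sum>j=1..n. exp ((x j)\<^sup>2 / 4)) / real n"
  have "real i * exp ?y \<le> (\<Sum>j=1..n. exp (\<bar>x j\<bar>\<^sup>2 / 4))"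
    using mult_rearr_le_sum[OF i, of "\<lambda>u. exp (u\<^sup>2 / 4)" x]
    by (auto simp: mono_on_def power_mono)
  then have "exp ?y / (real n / real i) \<le> ?W" using i by (simp add: field_simps)
  then have "exp (?y - ln (real n / real i)) \<le> ?W" using i by (simp only: exp_diff) simp
  then have "1 + (?y - ln (real n / real i)) \<le> ?W" by (rule order_trans[OF exp_ge_add_one_self])
  then show ?thesis by argo
qed

section \<open>Power sums\<close>

text \<open>
  A linear majorant of a concave power, off by a factor 2 at \<open>s = m\<close>. It stands in for both Jensen's and Hoelder's inequality
  below: with \<open>m\<close> of the right order of magnitude,
  sums of powers reduce to sums of the arguments themselves.
\<close>
lemma powr_le_linear:
  fixes s m \<theta> :: real
  assumes "0 \<le> s" "0 < m" "0 \<le> \<theta>" "\<theta> \<le> 1"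
  shows "s powr \<theta> \<le> m powr \<theta> * (1 + s / m)"
proof -
  have "s powr \<theta> \<le> (m * (1 + s / m)) powr \<theta>" using assms by (intro powr_mono2) (auto simp: field_simps)
  also have "\<dots> = m powr \<theta> * (1 + s / m) powr \<theta>" using assms by (simp add: powr_mult)
  also have "\<dots> \<le> m powr \<theta> * (1 + s / m) powr 1" using assms by (intro mult_left_mono powr_mono) auto
  finally show ?thesis using assms by simp
qed

text \<open>
  The primitive of \<open>x powr (a - 1)\<close> that vanishes at \<open>1\<close>, known as the Box-Cox transform. It covers
  the exponents \<open>a > 0\<close>, \<open>a = 0\<close> and \<open>a < 0\<close> at once, and passes continuously through
  the logarithm at \<open>a = 0\<close>.
\<close>
definition box_cox :: "real \<Rightarrow> real \<Rightarrow> real" where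
  "box_cox a x = (if a = 0 then ln x else (x powr a - 1) / a)"

lemma box_cox_1 [simp]: "box_cox a 1 = 0" by (simp add: box_cox_def)

lemma has_real_derivative_box_cox:
  assumes "x > 0"
  shows "(box_cox a has_real_derivative x powr (a - 1)) (at x)"
proof (cases "a = 0")
  case True
  then have "box_cox a = ln" by (auto simp: box_cox_def)
  then show ?thesis using assms True DERIV_ln[of x] by (simp add: powr_minus)
next
  case False
  then have "box_cox a = (\<lambda>x. (x powr a - 1) / a)" by (auto simp: box_cox_def)
  then show ?thesis using assms False by (auto intro!: derivative_eq_intros)
qed

lemma box_cox_diff_bounds:
  assumes "0 < x" "x < y" "a \<le> 1"
  shows "(y - x) * y powr (a - 1) \<le> box_cox a y - box_cox a x"
    and "box_cox a y - box_cox a x \<le> (y - x) * x powr (a - 1)"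
proof -
  have "\<exists>z>x. z < y \<and> box_cox a y - box_cox a x = (y - x) * z powr (a - 1)"
    by (rule MVT2) (use assms has_real_derivative_box_cox in auto)
  then obtain z where z: "x < z" "z < y" "box_cox a y - box_cox a x = (y - x) * z powr (a - 1)"
    by auto
  have "y powr (a - 1) \<le> z powr (a - 1)" "z powr (a - 1) \<le> x powr (a - 1)"
    using assms z by (auto intro!: powr_mono2')
  then show "(y - x) * y powr (a - 1) \<le> box_cox a y - box_cox a x"
    "box_cox a y - box_cox a x \<le> (y - x) * x powr (a - 1)"
    unfolding z(3) using assms by (auto intro!: mult_left_mono)
qed

text \<open>
  Comparison of the sum with the integral of a decreasing function, by telescoping; the \<open>1\<close> is
  the first term.
\<close>
lemma sum_powr_le:
  assumes "a \<le> 1" "n \<ge> 1"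
  shows "(\<Sum>i=1..n. real i powr (a - 1)) \<le> 1 + box_cox a (real n)"
  using assms(2)
proof (induction n rule: nat_induct_at_least)
  case (Suc n)
  then show ?case using box_cox_diff_bounds(1)[of "real n" "real (Suc n)" a] assms by simp
qed simp

lemma sum_powr_ge:
  assumes "a \<le> 1"
  shows "box_cox a (real n + 1) \<le> (\<Sum>i=1..n. real i powr (a - 1))"
proof (induction n)
  case (Suc n)
  then show ?case using box_cox_diff_bounds(2)[of "real (Suc n)" "real (Suc n) + 1" a] assms
    by (simp add: algebra_simps)
qed simp

lemma box_cox_mono:
  assumes "0 < x" "x \<le> y" "a \<le> 1"
  shows "box_cox a x \<le> box_cox a y"
proof (cases "x = y")
  case False
  have "0 \<le> (y - x) * y powr (a - 1)" using assms by simp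
  also have "\<dots> \<le> box_cox a y - box_cox a x" using assms False by (intro box_cox_diff_bounds(1)) auto
  finally show ?thesis by simp
qed simp

lemma one_minus_exp_ge:
  fixes u :: real
  assumes "u \<ge> 0"
  shows "u / (1 + u) \<le> 1 - exp (- u)"
proof -
  have "exp (- u) \<le> inverse (1 + u)"
    unfolding exp_minus using assms exp_ge_add_one_self[of u] by (intro le_imp_inverse_le) auto
  then show ?thesis using assms by (simp add: field_simps)
qed

text \<open>
  The quotient \<open>l / (1 + a * l)\<close> with \<open>l = ln x\<close> is comparable to \<open>min l (1 / a)\<close>. It is written in
  this form so that the constants do not degenerate as \<open>a\<close> tends to \<open>0\<close>.
\<close>
lemma box_cox_ge_nonneg:
  assumes "0 \<le> a" "1 \<le> x"
  shows "x powr a * (ln x / (1 + a * ln x)) \<le> box_cox a x"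
proof (cases "a = 0")
  case False
  have u: "a * ln x \<ge> 0" using assms by simp
  have "a * ln x / (1 + a * ln x) \<le> 1 - exp (- (a * ln x))" by (rule one_minus_exp_ge[OF u])
  then have "x powr a * (a * ln x / (1 + a * ln x)) \<le> x powr a * (1 - exp (- (a * ln x)))"
    by (intro mult_left_mono) auto
  also have "\<dots> = x powr a - 1" using assms by (simp add: powr_def exp_minus field_simps)
  finally show ?thesis using False assms by (simp add: box_cox_def field_simps)
qed (use assms in \<open>auto simp: box_cox_def\<close>)

lemma box_cox_ge_nonpos:
  assumes "0 \<le> b" "1 \<le> x"
  shows "ln x / (1 + b * ln x) \<le> box_cox (- b) x"
proof (cases "b = 0")
  case False
  have u: "b * ln x \<ge> 0" using assms by simp
  have "b * ln x / (1 + b * ln x) \<le> 1 - x powr (- b)"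
    using one_minus_exp_ge[OF u] assms by (simp add: powr_def)
  then have "(b * ln x / (1 + b * ln x)) / b \<le> (1 - x powr (- b)) / b"
    using assms by (intro divide_right_mono) auto
  moreover have "(b * ln x / (1 + b * ln x)) / b = ln x / (1 + b * ln x)" using False by simp
  moreover have "(1 - x powr (- b)) / b = box_cox (- b) x"
    using False by (simp add: box_cox_def diff_divide_distrib)
  ultimately show ?thesis by simp
qed (use assms in \<open>auto simp: box_cox_def\<close>)

lemma sum_powr_le_pos:
  assumes "0 < a" "a \<le> 1" "n \<ge> 1"
  shows "(\<Sum>i=1..n. real i powr (a - 1)) \<le> real n powr a / a"
  using sum_powr_le[of a n] assms by (simp add: box_cox_def field_simps)

lemma sum_powr_le_neg:
  assumes "0 < b" "n \<ge> 1"
  shows "(\<Sum>i=1..n. real i powr (- b - 1)) \<le> 1 + 1 / b"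
proof -
  have "box_cox (- b) (real n) \<le> 1 / b" using assms by (simp add: box_cox_def field_simps)
  then show ?thesis using sum_powr_le[of "- b" n] assms by simp
qed

lemma sum_inverse_le:
  assumes "n \<ge> 1" 
  shows "(\<Sum>i=1..n. real i powr (- 1)) \<le> 1 + ln (real n)"
  using sum_powr_le[of 0 n] assms by (simp add: box_cox_def)

lemma ln_ge_1: "n \<ge> 3 \<Longrightarrow> 1 \<le> ln (real n)"
  using e_less_272 by (subst ln_ge_iff) auto

lemma ln_div_le_powr:
  assumes "0 < a" "1 \<le> i" "i \<le> n"
  shows "ln (real n / real i) \<le> (real n / real i) powr a / a"
proof -
  have "a * ln (real n / real i) \<le> exp (a * ln (real n / real i))"
    using exp_ge_add_one_self[of "a * ln (real n / real i)"] by linarith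
  also have "\<dots> = (real n / real i) powr a" using assms by (simp add: powr_def)
  finally show ?thesis using assms by (simp add: field_simps)
qed

section \<open>Sums with logarithms\<close>

lemma ratio_mono:
  fixes a x y :: real
  assumes "0 \<le> a" "0 \<le> x" "x \<le> y"
  shows "x / (1 + a * x) \<le> y / (1 + a * y)"
proof -
  have "0 \<le> a * x" "0 \<le> a * y" using assms by auto
  then have "0 < 1 + a * x" "0 < 1 + a * y" by auto
  then show ?thesis using assms by (simp add: divide_simps algebra_simps)
qed

text \<open>
  The two regimes of \<open>x / (1 + a * x)\<close>, which is within a factor 2 of \<open>min x (1 / a)\<close>.
\<close>
lemma ratio_ge_half:
  fixes a x :: real
  assumes "0 \<le> a" "1 \<le> x"
  shows "a * x \<le> 1 \<Longrightarrow> x \<le> 2 * (x / (1 + a * x))"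
    and "1 \<le> a * x \<Longrightarrow> 1 / a \<le> 2 * (x / (1 + a * x))"
proof -
  have pos: "0 < 1 + a * x" using assms by (simp add: add_pos_nonneg)
  show "x \<le> 2 * (x / (1 + a * x))" if "a * x \<le> 1"
  proof -
    have "x * (1 + a * x) \<le> x * 2" using that assms by (intro mult_left_mono) auto
    then show ?thesis using pos by (simp add: field_simps)
  qed
  show "1 / a \<le> 2 * (x / (1 + a * x))" if "1 \<le> a * x"
  proof -
    have "a > 0" using that assms by (cases "a = 0") auto
    then show ?thesis using pos that by (simp add: field_simps)
  qed
qed

text \<open>
  Write \<open>i = n * exp (- s)\<close>. Then the sums behave like \<open>n powr a\<close> times the integrals of
  \<open>exp (- a * s)\<close> and of \<open>s * exp (- a * s)\<close> over \<open>0 \<le> s \<le> ln n\<close>, where the effective range of \<open>s\<close> is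
  \<open>min (ln n) (1 / a) \<approx> M\<close>. If \<open>a * ln n \<le> 1\<close> the exponential is harmless; otherwise half of the
  exponent \<open>a\<close> pays for the logarithm.
\<close>
lemma sum_powr_le_ratio:
  fixes a :: real
  assumes a: "0 \<le> a" "a \<le> 1" and n: "n \<ge> 3"
  defines "M \<equiv> ln (real n) / (1 + a * ln (real n))"
  shows "(\<Sum>i=1..n. real i powr (a - 1)) \<le> 4 * real n powr a * M"
    and "(\<Sum>i=1..n. real i powr (a - 1) * ln (real n / real i)) \<le> 16 * real n powr a * M\<^sup>2"
proof -
  let ?L = "ln (real n)"
  have L: "1 \<le> ?L" by (rule ln_ge_1[OF n])
  have M: "0 \<le> M" unfolding M_def using a L by (intro divide_nonneg_nonneg) (auto intro!: add_nonneg_nonneg mult_nonneg_nonneg)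
  have "(\<Sum>i=1..n. real i powr (a - 1)) \<le> 4 * real n powr a * M \<and>
    (\<Sum>i=1..n. real i powr (a - 1) * ln (real n / real i)) \<le> 16 * real n powr a * M\<^sup>2"
  proof (cases "a * ?L \<le> 1")
    case True
    have LM: "?L \<le> 2 * M" unfolding M_def by (rule ratio_ge_half(1)[OF a(1) L True])
    have "(\<Sum>i=1..n. real i powr (a - 1)) \<le> (\<Sum>i=1..n. real n powr a * real i powr (- 1))"
    proof (rule sum_mono)
      fix i assume i: "i \<in> {1..n}"
      have "real i powr (a - 1) = real i powr a * real i powr (- 1)"
        by (subst powr_add[symmetric]) simp
      also have "\<dots> \<le> real n powr a * real i powr (- 1)"
        using i a by (intro mult_right_mono powr_mono2) auto
      finally show "real i powr (a - 1) \<le> real n powr a * real i powr (- 1)" .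
    qed
    also have "\<dots> \<le> real n powr a * (1 + ?L)"
      unfolding sum_distrib_left[symmetric] using sum_inverse_le[of n] n by (intro mult_left_mono) auto
    also have "\<dots> \<le> real n powr a * (4 * M)" using LM L by (intro mult_left_mono) auto
    finally have 1: "(\<Sum>i=1..n. real i powr (a - 1)) \<le> real n powr a * (4 * M)" .
    have "(\<Sum>i=1..n. real i powr (a - 1) * ln (real n / real i)) \<le> (\<Sum>i=1..n. real i powr (a - 1) * ?L)"
      by (intro sum_mono mult_left_mono) (auto simp: field_simps)
    also have "\<dots> = (\<Sum>i=1..n. real i powr (a - 1)) * ?L" by (simp add: sum_distrib_right)
    also have "\<dots> \<le> (real n powr a * (4 * M)) * (2 * M)" using 1 LM L M by (intro mult_mono mult_nonneg_nonneg) auto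
    also have "\<dots> = 8 * (real n powr a * M\<^sup>2)" by (simp add: power2_eq_square)
    also have "\<dots> \<le> 16 * (real n powr a * M\<^sup>2)" by (intro mult_right_mono) auto
    finally show ?thesis using 1 by (simp add: mult_ac)
  next
    case False
    then have a0: "0 < a" using a by (cases "a = 0") auto
    have aM: "1 / a \<le> 2 * M" unfolding M_def using ratio_ge_half(2)[OF a(1) L] False by auto
    have "(\<Sum>i=1..n. real i powr (a - 1)) \<le> real n powr a * (1 / a)"
      using sum_powr_le_pos[of a n] a0 a n by simp
    also have "\<dots> \<le> real n powr a * (4 * M)" using aM M by (intro mult_left_mono) auto
    finally have 1: "(\<Sum>i=1..n. real i powr (a - 1)) \<le> real n powr a * (4 * M)" .
    have "(\<Sum>i=1..n. real i powr (a - 1) * ln (real n / real i))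
        \<le> (\<Sum>i=1..n. (2 / a * real n powr (a / 2)) * real i powr (a / 2 - 1))"
    proof (rule sum_mono)
      fix i assume i: "i \<in> {1..n}"
      have "real i powr (a - 1) * ln (real n / real i) \<le> real i powr (a - 1) * ((real n / real i) powr (a / 2) / (a / 2))"
        using i a0 by (intro mult_left_mono ln_div_le_powr) auto
      also have "\<dots> = 2 / a * real n powr (a / 2) * (real i powr (a - 1) * real i powr (- (a / 2)))"
        using i by (simp add: powr_divide powr_minus field_simps)
      also have "real i powr (a - 1) * real i powr (- (a / 2)) = real i powr (a / 2 - 1)"
        by (simp add: field_simps flip: powr_add)
      finally show "real i powr (a - 1) * ln (real n / real i) \<le> (2 / a * real n powr (a / 2)) * real i powr (a / 2 - 1)" .
    qed
    also have "\<dots> \<le> (2 / a * real n powr (a / 2)) * (real n powr (a / 2) / (a / 2))"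
      unfolding sum_distrib_left[symmetric] using sum_powr_le_pos[of "a / 2" n] a0 a n
      by (intro mult_left_mono) auto
    also have "\<dots> = 4 * (real n powr (a / 2) * real n powr (a / 2)) * (1 / a)\<^sup>2" by (simp add: power2_eq_square)
    also have "real n powr (a / 2) * real n powr (a / 2) = real n powr a" by (simp flip: powr_add)
    also have "4 * real n powr a * (1 / a)\<^sup>2 \<le> 4 * real n powr a * (2 * M)\<^sup>2"
      using aM a0 by (intro mult_left_mono power_mono) auto
    finally show ?thesis using 1 by (simp add: power2_eq_square algebra_simps)
  qed
  then show "(\<Sum>i=1..n. real i powr (a - 1)) \<le> 4 * real n powr a * M"
    "(\<Sum>i=1..n. real i powr (a - 1) * ln (real n / real i)) \<le> 16 * real n powr a * M\<^sup>2" by auto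
qed

text \<open>
  Linearising the power \<open>\<theta>\<close> at \<open>M\<close>, the typical size of \<open>ln (n / i)\<close> under the weights
  \<open>i powr (a - 1)\<close>, reduces this to the two sums of the previous lemma.
\<close>
lemma log_sum_le_nonneg:
  fixes a \<theta> :: real
  assumes a: "0 \<le> a" "a \<le> 1" and n: "n \<ge> 3" and \<theta>: "0 \<le> \<theta>" "\<theta> \<le> 1"
  defines "M \<equiv> ln (real n) / (1 + a * ln (real n))"
  shows "(\<Sum>i=1..n. real i powr (a - 1) * (1 + ln (real n / real i)) powr \<theta>)
    \<le> 28 * real n powr a * M powr (\<theta> + 1)"
proof -
  let ?L = "ln (real n)"
  have L: "1 \<le> ?L" by (rule ln_ge_1[OF n])
  have "1 / (1 + a * 1) \<le> M" unfolding M_def using ratio_mono[of a 1 ?L] a L by simp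
  moreover have "1 / 2 \<le> 1 / (1 + a * 1)" using a by (intro divide_left_mono) auto
  ultimately have M: "1 / 2 \<le> M" by linarith
  have "(\<Sum>i=1..n. real i powr (a - 1) * (1 + ln (real n / real i)) powr \<theta>)
    \<le> (\<Sum>i=1..n. M powr \<theta> * (3 * real i powr (a - 1) + real i powr (a - 1) * ln (real n / real i) / M))"
  proof (rule sum_mono)
    fix i assume i: "i \<in> {1..n}"
    have s: "0 \<le> ln (real n / real i)" using i by (intro ln_ge_zero) auto
    have "(1 + ln (real n / real i)) powr \<theta> \<le> M powr \<theta> * (1 + (1 + ln (real n / real i)) / M)"
      using s M \<theta> by (intro powr_le_linear) auto
    also have "\<dots> \<le> M powr \<theta> * (3 + ln (real n / real i) / M)"
    proof -
      have "1 / M \<le> 1 / (1 / 2)" using M by (intro divide_left_mono) auto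
      then have "1 + (1 + ln (real n / real i)) / M \<le> 3 + ln (real n / real i) / M"
        by (simp add: add_divide_distrib)
      then show ?thesis by (intro mult_left_mono) auto
    qed
    finally have "real i powr (a - 1) * (1 + ln (real n / real i)) powr \<theta>
      \<le> real i powr (a - 1) * (M powr \<theta> * (3 + ln (real n / real i) / M))" by (intro mult_left_mono) auto
    then show "real i powr (a - 1) * (1 + ln (real n / real i)) powr \<theta>
      \<le> M powr \<theta> * (3 * real i powr (a - 1) + real i powr (a - 1) * ln (real n / real i) / M)"
      by (simp add: algebra_simps)
  qed
  also have "\<dots> = M powr \<theta> * (3 * (\<Sum>i=1..n. real i powr (a - 1)) + (\<Sum>i=1..n. real i powr (a - 1) * ln (real n / real i)) / M)"
    by (simp only: sum_distrib_left[symmetric] sum.distrib sum_divide_distrib[symmetric])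
  also have "\<dots> \<le> M powr \<theta> * (3 * (4 * real n powr a * M) + (16 * real n powr a * M\<^sup>2) / M)"
    using sum_powr_le_ratio[OF a n] M unfolding M_def[symmetric]
    by (intro mult_left_mono add_mono divide_right_mono) auto
  also have "\<dots> = 28 * real n powr a * (M powr \<theta> * M powr 1)" using M by (simp add: power2_eq_square)
  also have "M powr \<theta> * M powr 1 = M powr (\<theta> + 1)" by (simp add: powr_add)
  finally show ?thesis .
qed

text \<open>
  For weights with exponent at most \<open>-1\<close> the indices up to \<open>sqrt n\<close> carry a fixed proportion of the sum, and
  there \<open>ln (n / i)\<close> is of the order of \<open>ln n\<close>, so replacing it by \<open>ln n\<close> costs only a constant.
\<close>
lemma log_sum_le_nonpos:
  fixes b \<theta> :: real
  assumes b: "0 \<le> b" "b \<le> 3" and n: "n \<ge> 3" and \<theta>: "0 \<le> \<theta>" "\<theta> \<le> 1"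
  defines "L \<equiv> ln (real n)"
  shows "(\<Sum>i=1..n. real i powr (- b - 1) * (1 + ln (real n / real i)) powr \<theta>)
    \<le> 16 * L powr \<theta> * (L / (1 + b * L))"
proof -
  have L: "1 \<le> L" unfolding L_def by (rule ln_ge_1[OF n])
  have S: "(\<Sum>i=1..n. real i powr (- b - 1)) \<le> 8 * (L / (1 + b * L))"
  proof (cases "b * L \<le> 1")
    case True
    have "(\<Sum>i=1..n. real i powr (- b - 1)) \<le> (\<Sum>i=1..n. real i powr (- 1))"
      using b by (intro sum_mono powr_mono) auto
    also have "\<dots> \<le> 1 + L" unfolding L_def using sum_inverse_le[of n] n by simp
    finally show ?thesis using ratio_ge_half(1)[OF b(1) L True] L by linarith
  next
    case False
    then have b0: "0 < b" using b by (cases "b = 0") auto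
    have "(\<Sum>i=1..n. real i powr (- b - 1)) \<le> 1 + 1 / b" using sum_powr_le_neg[OF b0, of n] n by simp
    also have "\<dots> \<le> 4 * (1 / b)" using b0 b by (simp add: field_simps)
    finally show ?thesis using ratio_ge_half(2)[OF b(1) L] False by linarith
  qed
  have "(\<Sum>i=1..n. real i powr (- b - 1) * (1 + ln (real n / real i)) powr \<theta>)
      \<le> (\<Sum>i=1..n. real i powr (- b - 1) * (2 * L powr \<theta>))"
  proof (intro sum_mono mult_left_mono)
    fix i assume i: "i \<in> {1..n}"
    have s: "0 \<le> ln (real n / real i)" using i by (intro ln_ge_zero) auto
    have "ln (real n / real i) \<le> L" unfolding L_def using i by (simp add: field_simps)
    then have "(1 + ln (real n / real i)) powr \<theta> \<le> (2 * L) powr \<theta>" using s L \<theta> by (intro powr_mono2) auto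
    also have "\<dots> = 2 powr \<theta> * L powr \<theta>" using L by (simp add: powr_mult)
    also have "\<dots> \<le> 2 powr 1 * L powr \<theta>" using \<theta> by (intro mult_right_mono powr_mono) auto
    finally show "(1 + ln (real n / real i)) powr \<theta> \<le> 2 * L powr \<theta>" by simp
  qed auto
  also have "\<dots> = (\<Sum>i=1..n. real i powr (- b - 1)) * (2 * L powr \<theta>)" by (simp add: sum_distrib_right)
  also have "\<dots> \<le> (8 * (L / (1 + b * L))) * (2 * L powr \<theta>)" using S by (intro mult_right_mono) auto
  finally show ?thesis by (simp add: algebra_simps)
qed

section \<open>The rearranged sum and single order statistics\<close>

lemma square_powr:
  fixes x \<theta> :: real
  assumes "0 \<le> x"
  shows "x powr (2 * \<theta>) = (x\<^sup>2) powr \<theta>"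
proof (cases "x = 0")
  case False
  then show ?thesis using assms by (simp add: powr_powr flip: powr_numeral)
qed simp

lemma rearr_sum_le:
  assumes \<theta>: "0 \<le> p - 1" "p - 1 \<le> 1" and W: "(\<Sum>j=1..n. exp ((x j)\<^sup>2 / 4)) / real n \<le> 4"
  shows "rearr_sum n r p x \<le> 16 * (\<Sum>i=1..n. real i powr (- 2 * r) * (1 + ln (real n / real i)) powr (p - 1))"
  unfolding rearr_sum_def sum_distrib_left
proof (rule sum_mono)
  fix i assume i: "i \<in> {1..n}"
  have s: "0 \<le> ln (real n / real i)" using i by (intro ln_ge_zero) auto
  have "(rearr n x i)\<^sup>2 \<le> 4 * (ln (real n / real i) + (\<Sum>j=1..n. exp ((x j)\<^sup>2 / 4)) / real n)"
    using i by (intro rearr_square_le) auto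
  also have "\<dots> \<le> 16 * (1 + ln (real n / real i))" using W s by argo
  finally have "rearr n x i powr (2 * (p - 1)) \<le> (16 * (1 + ln (real n / real i))) powr (p - 1)"
    using i rearr_nonneg[of i n x] \<theta> by (subst square_powr) (auto intro!: powr_mono2)
  also have "\<dots> = 16 powr (p - 1) * (1 + ln (real n / real i)) powr (p - 1)" using s by (subst powr_mult) auto
  also have "\<dots> \<le> 16 powr 1 * (1 + ln (real n / real i)) powr (p - 1)"
    using \<theta> by (intro mult_right_mono powr_mono) auto
  finally have "real i powr (- 2 * r) * rearr n x i powr (2 * (p - 1))
      \<le> real i powr (- 2 * r) * (16 * (1 + ln (real n / real i)) powr (p - 1))"
    by (intro mult_left_mono) auto
  then show "real i powr (- 2 * r) * rearr n x i powr (2 * (p - 1))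
      \<le> 16 * (real i powr (- 2 * r) * (1 + ln (real n / real i)) powr (p - 1))" by (simp add: algebra_simps)
qed

text \<open>
  One lower bound on a single order statistic is enough: it bounds all the larger ones.
\<close>
lemma rearr_sum_ge:
  assumes p: "1 \<le> p" and J: "1 \<le> J" "J \<le> n" and t: "0 \<le> t" "t \<le> rearr n x J"
  shows "t powr (2 * (p - 1)) * (\<Sum>i=1..J. real i powr (- 2 * r)) \<le> rearr_sum n r p x"
proof -
  have "t powr (2 * (p - 1)) * (\<Sum>i=1..J. real i powr (- 2 * r))
      = (\<Sum>i=1..J. real i powr (- 2 * r) * t powr (2 * (p - 1)))"
    by (simp add: sum_distrib_left mult.commute)
  also have "\<dots> \<le> (\<Sum>i=1..J. real i powr (- 2 * r) * rearr n x i powr (2 * (p - 1)))"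
  proof (intro sum_mono mult_left_mono powr_mono2)
    fix i assume "i \<in> {1..J}"
    then show "t \<le> rearr n x i" using rearr_antimono[of i J n x] J t by auto
  qed (use p t in auto)
  also have "\<dots> \<le> (\<Sum>i=1..n. real i powr (- 2 * r) * rearr n x i powr (2 * (p - 1)))"
    using J by (intro sum_mono2) auto
  finally show ?thesis by (simp add: rearr_sum_def)
qed

text \<open>
  The cut-off \<open>J\<close> is the last index with \<open>ln (n / i) \<ge> \<kappa>\<close>. As long as \<open>\<kappa>\<close> is at most half of \<open>ln n\<close>,
  cutting the sum there costs only a factor 2 and, for positive \<open>a\<close>, the factor \<open>exp (- a * \<kappa>)\<close>.
\<close>
lemma partial_sum_ge:
  assumes n: "n \<ge> 1" and \<kappa>: "0 \<le> \<kappa>" "\<kappa> \<le> ln (real n) / 2"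
  defines "J \<equiv> nat \<lfloor>real n * exp (- \<kappa>)\<rfloor>"
  shows "1 \<le> J" "J \<le> n" "real J \<le> real n * exp (- \<kappa>)"
    and "0 \<le> a \<Longrightarrow> a \<le> 1 \<Longrightarrow> real n powr a * exp (- a * \<kappa>) * (ln (real n) / (1 + a * ln (real n)) / 2)
      \<le> (\<Sum>i=1..J. real i powr (a - 1))"
    and "0 \<le> b \<Longrightarrow> ln (real n) / (1 + b * ln (real n)) / 2 \<le> (\<Sum>i=1..J. real i powr (- b - 1))"
proof -
  let ?I = "real n * exp (- \<kappa>)" and ?L = "ln (real n)"
  have L: "0 \<le> ?L" using n by simp
  have lnI: "ln ?I = ?L - \<kappa>" using n by (simp add: ln_mult)
  then have I: "1 \<le> ?I" using \<kappa> L n by (subst ln_ge_zero_iff[symmetric]) auto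
  then have "1 \<le> \<lfloor>?I\<rfloor>" by simp
  then show J1: "1 \<le> J" unfolding J_def by linarith
  show J: "real J \<le> ?I" unfolding J_def using I by (simp add: of_nat_floor)
  have "?I \<le> real n * 1" using \<kappa> by (intro mult_left_mono) auto
  then show "J \<le> n" using J by simp
  have JI: "?I \<le> real J + 1" unfolding J_def using I by linarith
  have half: "?L / 2 \<le> ln ?I" using lnI \<kappa> by simp
  have ratio: "?L / (1 + c * ?L) / 2 \<le> ln ?I / (1 + c * ln ?I)" if c: "0 \<le> c" for c
  proof -
    have "0 \<le> c * ?L" using c L by simp
    then have "(?L / 2) / (1 + c * ?L) \<le> (?L / 2) / (1 + c * (?L / 2))"
      using L by (intro divide_left_mono mult_pos_pos) auto
    then have "?L / (1 + c * ?L) / 2 \<le> (?L / 2) / (1 + c * (?L / 2))"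
      by (simp only: divide_divide_eq_left mult.commute)
    also have "\<dots> \<le> ln ?I / (1 + c * ln ?I)" using half L c by (intro ratio_mono) auto
    finally show ?thesis .
  qed
  show "real n powr a * exp (- a * \<kappa>) * (?L / (1 + a * ?L) / 2) \<le> (\<Sum>i=1..J. real i powr (a - 1))"
    if a: "0 \<le> a" "a \<le> 1"
  proof -
    have "real n powr a * exp (- a * \<kappa>) = ?I powr a" using n by (simp add: powr_mult exp_powr_real mult.commute)
    then have "real n powr a * exp (- a * \<kappa>) * (?L / (1 + a * ?L) / 2) \<le> ?I powr a * (ln ?I / (1 + a * ln ?I))"
      by (simp only:) (intro mult_left_mono ratio a, simp)
    also have "\<dots> \<le> box_cox a ?I" by (rule box_cox_ge_nonneg[OF a(1) I])
    also have "\<dots> \<le> box_cox a (real J + 1)" using I JI a by (intro box_cox_mono) auto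
    also have "\<dots> \<le> (\<Sum>i=1..J. real i powr (a - 1))" by (rule sum_powr_ge[OF a(2)])
    finally show ?thesis .
  qed
  show "?L / (1 + b * ?L) / 2 \<le> (\<Sum>i=1..J. real i powr (- b - 1))" if b: "0 \<le> b"
  proof -
    have "?L / (1 + b * ?L) / 2 \<le> ln ?I / (1 + b * ln ?I)" by (rule ratio[OF b])
    also have "\<dots> \<le> box_cox (- b) ?I" by (rule box_cox_ge_nonpos[OF b I])
    also have "\<dots> \<le> box_cox (- b) (real J + 1)" using I JI b by (intro box_cox_mono) auto
    also have "\<dots> \<le> (\<Sum>i=1..J. real i powr (- b - 1))" using b by (intro sum_powr_ge) auto
    finally show ?thesis .
  qed
qed

section \<open>Gaussian coordinates\<close>

lemma std_normal_vectorD: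
  assumes "std_normal_vector M n X"
  shows "prob_space M" "prob_space.indep_vars M (\<lambda>_. borel) X {1..n}"
    "\<And>i. i \<in> {1..n} \<Longrightarrow> distributed M lborel (X i) (\<lambda>x. ennreal (std_normal_density x))"
    "\<And>i. i \<in> {1..n} \<Longrightarrow> X i \<in> borel_measurable M"
proof -
  show "prob_space M" "prob_space.indep_vars M (\<lambda>_. borel) X {1..n}"
    using assms by (auto simp: std_normal_vector_def)
  show D: "distributed M lborel (X i) (\<lambda>x. ennreal (std_normal_density x))" if "i \<in> {1..n}" for i
    using assms that by (auto simp: std_normal_vector_def)
  show "X i \<in> borel_measurable M" if "i \<in> {1..n}" for i
    using distributed_measurable[OF D[OF that]] by simp
qed

lemma nn_integral_coordinate:
  assumes "std_normal_vector M n X" "i \<in> {1..n}" and [measurable]: "g \<in> borel_measurable borel"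
  shows "(\<integral>\<^sup>+\<omega>. g (X i \<omega>) \<partial>M) = (\<integral>\<^sup>+x. ennreal (std_normal_density x) * g x \<partial>lborel)"
  using std_normal_vectorD(3)[OF assms(1,2)] by (subst distributed_nn_integral) auto

lemma nn_integral_prod_coordinates:
  assumes N: "std_normal_vector M n X" and [measurable]: "g \<in> borel_measurable borel"
  shows "(\<integral>\<^sup>+\<omega>. (\<Prod>i=1..n. g (X i \<omega>)) \<partial>M) = (\<integral>\<^sup>+x. ennreal (std_normal_density x) * g x \<partial>lborel) ^ n"
proof -
  interpret prob_space M by (rule std_normal_vectorD[OF N])
  have "(\<integral>\<^sup>+\<omega>. (\<Prod>i\<in>{1..n}. g (X i \<omega>)) \<partial>M) = (\<Prod>i\<in>{1..n}. \<integral>\<^sup>+\<omega>. g (X i \<omega>) \<partial>M)"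
    by (intro indep_vars_nn_integral indep_vars_compose2[OF std_normal_vectorD(2)[OF N]]) auto
  also have "\<dots> = (\<Prod>i\<in>{1..n}. \<integral>\<^sup>+x. ennreal (std_normal_density x) * g x \<partial>lborel)"
    by (intro prod.cong refl nn_integral_coordinate[OF N]) auto
  finally show ?thesis by simp
qed

lemma nn_integral_normal_density:
  assumes "\<sigma> > 0"
  shows "(\<integral>\<^sup>+x. ennreal (normal_density \<mu> \<sigma> x) \<partial>lborel) = 1"
  using prob_space.emeasure_space_1[OF prob_space_normal_density[OF assms, of \<mu>]]
  by (simp add: emeasure_density)

lemma nn_integral_exp_square_quarter:
  "(\<integral>\<^sup>+x. ennreal (std_normal_density x) * ennreal (exp (x\<^sup>2 / 4)) \<partial>lborel) = ennreal (sqrt 2)"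
proof -
  have eq: "std_normal_density x * exp (x\<^sup>2 / 4) = sqrt 2 * normal_density 0 (sqrt 2) x" for x
    by (simp add: normal_density_def real_sqrt_mult field_simps flip: exp_add)
  have "(\<integral>\<^sup>+x. ennreal (std_normal_density x) * ennreal (exp (x\<^sup>2 / 4)) \<partial>lborel)
      = (\<integral>\<^sup>+x. ennreal (sqrt 2) * ennreal (normal_density 0 (sqrt 2) x) \<partial>lborel)"
    by (intro nn_integral_cong) (simp add: eq flip: ennreal_mult)
  also have "\<dots> = ennreal (sqrt 2)"
    by (subst nn_integral_cmult) (auto simp: nn_integral_normal_density)
  finally show ?thesis .
qed

text \<open>
  Up to \<open>u + 1\<close> the Gaussian exponent is at most \<open>(u + 1)\<^sup>2 / 2 \<le> u\<^sup>2 + 1\<close>, and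
  \<open>sqrt (2 * pi) * exp 1 < 7\<close>.
\<close>
lemma std_normal_density_ge:
  assumes "0 \<le> x" "x \<le> u + 1" "0 \<le> u"
  shows "exp (- u\<^sup>2) / 7 \<le> std_normal_density x"
proof -
  have "x\<^sup>2 \<le> (u + 1)\<^sup>2" using assms by (intro power_mono) auto
  also have "\<dots> \<le> 2 * u\<^sup>2 + 2" using zero_le_power2[of "u - 1"] by (simp add: power2_eq_square algebra_simps)
  finally have "- u\<^sup>2 - 1 \<le> - x\<^sup>2 / 2" by simp
  then have e: "exp (- u\<^sup>2 - 1) \<le> exp (- x\<^sup>2 / 2)" by simp
  have "sqrt (2 * pi) \<le> sqrt (2.55\<^sup>2)"
    using pi_less_4 pi_approx by (intro real_sqrt_le_mono) (simp add: power2_eq_square)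
  then have s: "sqrt (2 * pi) \<le> 2.55" by simp
  have "sqrt (2 * pi) * exp 1 \<le> 2.55 * 2.72" using s e_less_272 by (intro mult_mono) auto
  then have "1 / 7 \<le> 1 / (sqrt (2 * pi) * exp 1)"
    by (intro divide_left_mono) auto
  then have "exp (- u\<^sup>2) * (1 / 7) \<le> exp (- u\<^sup>2) * (1 / (sqrt (2 * pi) * exp 1))"
    by (intro mult_left_mono) auto
  also have "\<dots> = exp (- u\<^sup>2 - 1) / sqrt (2 * pi)" by (simp add: exp_diff)
  also have "\<dots> \<le> exp (- x\<^sup>2 / 2) / sqrt (2 * pi)" using e by (intro divide_right_mono) auto
  finally show ?thesis by (simp add: normal_density_def)
qed

lemma normal_tail_ge:
  assumes "0 \<le> u"
  shows "ennreal (exp (- u\<^sup>2) / 7) \<le> (\<integral>\<^sup>+x. ennreal (std_normal_density x) * indicator {u..} x \<partial>lborel)"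
proof -
  have "ennreal (exp (- u\<^sup>2) / 7) = (\<integral>\<^sup>+x. ennreal (exp (- u\<^sup>2) / 7) * indicator {u..u + 1} x \<partial>lborel)"
    by (subst nn_integral_cmult_indicator) auto
  also have "\<dots> \<le> (\<integral>\<^sup>+x. ennreal (std_normal_density x) * indicator {u..} x \<partial>lborel)"
    using std_normal_density_ge[of _ u] assms
    by (intro nn_integral_mono) (auto simp: indicator_def simp del: le_divide_eq_numeral1 divide_le_eq_numeral1 intro!: ennreal_leI)
  finally show ?thesis .
qed

lemma prob_coordinate_ge:
  assumes N: "std_normal_vector M n X" and i: "i \<in> {1..n}" and u: "0 \<le> u"
  shows "exp (- u\<^sup>2) / 7 \<le> measure M (X i -` {u..} \<inter> space M)"
proof -
  interpret prob_space M by (rule std_normal_vectorD[OF N])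
  note [measurable] = std_normal_vectorD(4)[OF N i]
  have "ennreal (exp (- u\<^sup>2) / 7) \<le> (\<integral>\<^sup>+\<omega>. indicator {u..} (X i \<omega>) \<partial>M)"
    by (subst nn_integral_coordinate[OF N i]) (auto intro: normal_tail_ge[OF u])
  also have "\<dots> = (\<integral>\<^sup>+\<omega>. indicator (X i -` {u..} \<inter> space M) \<omega> \<partial>M)"
    by (intro nn_integral_cong) (auto simp: indicator_def)
  also have "\<dots> = emeasure M (X i -` {u..} \<inter> space M)"
    by (intro nn_integral_indicator measurable_sets[of _ _ borel]) auto
  finally show ?thesis by (simp add: emeasure_eq_measure)
qed

lemma prob_box_ge:
  assumes N: "std_normal_vector M n X" and n: "n \<ge> 1" and u: "\<And>i. i \<in> {1..n} \<Longrightarrow> 0 \<le> u i"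
  shows "exp (- (\<Sum>i=1..n. (u i)\<^sup>2)) / 7 ^ n \<le> measure M {\<omega> \<in> space M. \<forall>i\<in>{1..n}. u i \<le> X i \<omega>}"
proof -
  interpret prob_space M by (rule std_normal_vectorD[OF N])
  have "exp (- (\<Sum>i=1..n. (u i)\<^sup>2)) / 7 ^ n = (\<Prod>i\<in>{1..n}. exp (- (u i)\<^sup>2) / 7)"
    by (simp add: prod_dividef exp_sum flip: sum_negf)
  also have "\<dots> \<le> (\<Prod>i\<in>{1..n}. prob (X i -` {u i..} \<inter> space M))"
    using prob_coordinate_ge[OF N _ u] by (intro prod_mono conjI) simp_all
  also have "\<dots> = prob (\<Inter>i\<in>{1..n}. X i -` {u i..} \<inter> space M)"
    using n by (intro indep_varsD_finite[OF std_normal_vectorD(2)[OF N], symmetric]) auto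
  also have "(\<Inter>i\<in>{1..n}. X i -` {u i..} \<inter> space M) = {\<omega> \<in> space M. \<forall>i\<in>{1..n}. u i \<le> X i \<omega>}"
    using n by auto
  finally show ?thesis .
qed

text \<open>
  Chernoff's bound with the exponential moment of order \<open>1 / 4\<close>.
\<close>
lemma prob_sum_squares_le:
  assumes N: "std_normal_vector M n X"
  shows "measure M {\<omega> \<in> space M. s \<le> (\<Sum>i=1..n. (X i \<omega>)\<^sup>2)} \<le> sqrt 2 ^ n * exp (- s / 4)"
proof -
  interpret prob_space M by (rule std_normal_vectorD[OF N])
  have [measurable]: "(\<lambda>\<omega>. X i \<omega>) \<in> borel_measurable M" if "i \<in> {1..n}" for i
    using std_normal_vectorD(4)[OF N that] .
  have "emeasure M {\<omega> \<in> space M. s \<le> (\<Sum>i=1..n. (X i \<omega>)\<^sup>2)}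
      \<le> emeasure M {\<omega> \<in> space M. 1 \<le> ennreal (exp (- s / 4)) * (\<Prod>i=1..n. ennreal (exp ((X i \<omega>)\<^sup>2 / 4)))}"
  proof (rule emeasure_mono)
    have "1 \<le> ennreal (exp (- s / 4)) * (\<Prod>i=1..n. ennreal (exp ((X i \<omega>)\<^sup>2 / 4)))"
      if "s \<le> (\<Sum>i=1..n. (X i \<omega>)\<^sup>2)" for \<omega>
    proof -
      have "(\<Prod>i=1..n. ennreal (exp ((X i \<omega>)\<^sup>2 / 4))) = ennreal (exp ((\<Sum>i=1..n. (X i \<omega>)\<^sup>2) / 4))"
        by (simp add: prod_ennreal sum_divide_distrib exp_sum)
      then show ?thesis using that by (simp flip: ennreal_mult exp_add)
    qed
    then show "{\<omega> \<in> space M. s \<le> (\<Sum>i=1..n. (X i \<omega>)\<^sup>2)}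
      \<subseteq> {\<omega> \<in> space M. 1 \<le> ennreal (exp (- s / 4)) * (\<Prod>i=1..n. ennreal (exp ((X i \<omega>)\<^sup>2 / 4)))}"
      by auto
  qed measurable
  also have "\<dots> \<le> ennreal (exp (- s / 4)) * (\<integral>\<^sup>+\<omega>. (\<Prod>i=1..n. ennreal (exp ((X i \<omega>)\<^sup>2 / 4))) * indicator (space M) \<omega> \<partial>M)"
    by (rule nn_integral_Markov_inequality) auto
  also have "(\<integral>\<^sup>+\<omega>. (\<Prod>i=1..n. ennreal (exp ((X i \<omega>)\<^sup>2 / 4))) * indicator (space M) \<omega> \<partial>M)
      = (\<integral>\<^sup>+\<omega>. (\<Prod>i=1..n. ennreal (exp ((X i \<omega>)\<^sup>2 / 4))) \<partial>M)"
    by (intro nn_integral_cong) auto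
  also have "\<dots> = ennreal (sqrt 2) ^ n"
    by (subst nn_integral_prod_coordinates[OF N, of "\<lambda>x. ennreal (exp (x\<^sup>2 / 4))"])
      (auto simp: nn_integral_exp_square_quarter)
  finally show ?thesis
    by (simp add: emeasure_eq_measure ennreal_power mult.commute flip: ennreal_mult)
qed

text \<open>
  Markov's inequality: the mean has expectation \<open>sqrt 2\<close>, and \<open>sqrt 2 / 4 < 1 / 2\<close>.
\<close>
lemma prob_mean_exp_square_ge_4:
  assumes N: "std_normal_vector M n X" and n: "n \<ge> 1"
  shows "measure M {\<omega> \<in> space M. 4 \<le> (\<Sum>i=1..n. exp ((X i \<omega>)\<^sup>2 / 4)) / real n} < 1 / 2"
    "{\<omega> \<in> space M. 4 \<le> (\<Sum>i=1..n. exp ((X i \<omega>)\<^sup>2 / 4)) / real n} \<in> sets M"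
proof -
  interpret prob_space M by (rule std_normal_vectorD[OF N])
  have [measurable]: "(\<lambda>\<omega>. X i \<omega>) \<in> borel_measurable M" if "i \<in> {1..n}" for i
    using std_normal_vectorD(4)[OF N that] .
  show "{\<omega> \<in> space M. 4 \<le> (\<Sum>i=1..n. exp ((X i \<omega>)\<^sup>2 / 4)) / real n} \<in> sets M"
    by measurable
  have "emeasure M {\<omega> \<in> space M. 4 \<le> (\<Sum>i=1..n. exp ((X i \<omega>)\<^sup>2 / 4)) / real n}
      \<le> emeasure M {\<omega> \<in> space M. 1 \<le> ennreal (1 / (4 * n)) * (\<Sum>i=1..n. ennreal (exp ((X i \<omega>)\<^sup>2 / 4)))}"
  proof (rule emeasure_mono)
    have "1 \<le> ennreal (1 / (4 * n)) * (\<Sum>i=1..n. ennreal (exp ((X i \<omega>)\<^sup>2 / 4)))"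
      if "4 \<le> (\<Sum>i=1..n. exp ((X i \<omega>)\<^sup>2 / 4)) / real n" for \<omega>
    proof -
      have "1 \<le> 1 / (4 * n) * (\<Sum>i=1..n. exp ((X i \<omega>)\<^sup>2 / 4))" using that n by (simp add: field_simps)
      then show ?thesis by (simp add: sum_nonneg flip: ennreal_mult)
    qed
    then show "{\<omega> \<in> space M. 4 \<le> (\<Sum>i=1..n. exp ((X i \<omega>)\<^sup>2 / 4)) / real n} \<subseteq>
      {\<omega> \<in> space M. 1 \<le> ennreal (1 / (4 * n)) * (\<Sum>i=1..n. ennreal (exp ((X i \<omega>)\<^sup>2 / 4)))}" by auto
  qed measurable
  also have "\<dots> \<le> ennreal (1 / (4 * n)) * (\<integral>\<^sup>+\<omega>. (\<Sum>i=1..n. ennreal (exp ((X i \<omega>)\<^sup>2 / 4))) * indicator (space M) \<omega> \<partial>M)"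
    by (rule nn_integral_Markov_inequality) auto
  also have "(\<integral>\<^sup>+\<omega>. (\<Sum>i=1..n. ennreal (exp ((X i \<omega>)\<^sup>2 / 4))) * indicator (space M) \<omega> \<partial>M)
      = (\<integral>\<^sup>+\<omega>. (\<Sum>i=1..n. ennreal (exp ((X i \<omega>)\<^sup>2 / 4))) \<partial>M)"
    by (intro nn_integral_cong) auto
  also have "\<dots> = (\<Sum>i=1..n. (\<integral>\<^sup>+\<omega>. ennreal (exp ((X i \<omega>)\<^sup>2 / 4)) \<partial>M))"
    by (intro nn_integral_sum) auto
  also have "\<dots> = (\<Sum>i=1..n. ennreal (sqrt 2))"
    by (intro sum.cong refl) (subst nn_integral_coordinate[OF N, of _ "\<lambda>x. ennreal (exp (x\<^sup>2 / 4))"],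
      auto simp: nn_integral_exp_square_quarter)
  also have "ennreal (1 / (4 * n)) * \<dots> = ennreal (sqrt 2 / 4)"
    using n by (simp add: ennreal_of_nat_eq_real_of_nat flip: ennreal_mult)
  finally have "prob {\<omega> \<in> space M. 4 \<le> (\<Sum>i=1..n. exp ((X i \<omega>)\<^sup>2 / 4)) / real n} \<le> sqrt 2 / 4"
    by (simp add: emeasure_eq_measure)
  moreover have "sqrt 2 < (2 :: real)" using sqrt2_less_2 by simp
  ultimately show "measure M {\<omega> \<in> space M. 4 \<le> (\<Sum>i=1..n. exp ((X i \<omega>)\<^sup>2 / 4)) / real n} < 1 / 2"
    by linarith
qed

text \<open>
  The expectation of \<open>2 powr - indicator\<close> of the exceedance of level \<open>t\<close>; it equals
  \<open>1 - q / 2\<close> with \<open>q\<close> the two-sided tail, and only \<open>q \<ge> exp (- t\<^sup>2) / 7\<close> is retained.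
\<close>
lemma nn_integral_half_tail_le:
  assumes "0 \<le> t"
  shows "(\<integral>\<^sup>+x. ennreal (std_normal_density x) * ennreal (if t \<le> \<bar>x\<bar> then 1 / 2 else 1) \<partial>lborel)
    \<le> ennreal (exp (- exp (- t\<^sup>2) / 14))"
proof -
  let ?q = "exp (- t\<^sup>2) / 7"
  let ?I = "\<integral>\<^sup>+x. ennreal (std_normal_density x) * ennreal (if t \<le> \<bar>x\<bar> then 1 / 2 else 1) \<partial>lborel"
  have "?I + ennreal (?q / 2) \<le> ?I + (\<integral>\<^sup>+x. ennreal (1 / 2) * (ennreal (std_normal_density x) * indicator {t..} x) \<partial>lborel)"
    using normal_tail_ge[OF assms]
    by (subst nn_integral_cmult)
      (auto simp: ennreal_mult[of "1/2" ?q, simplified] intro!: add_left_mono mult_left_mono)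
  also have "\<dots> = (\<integral>\<^sup>+x. ennreal (std_normal_density x) * ennreal (if t \<le> \<bar>x\<bar> then 1 / 2 else 1)
      + ennreal (1 / 2) * (ennreal (std_normal_density x) * indicator {t..} x) \<partial>lborel)"
    by (subst nn_integral_add) auto
  also have "\<dots> \<le> (\<integral>\<^sup>+x. ennreal (std_normal_density x) \<partial>lborel)"
  proof (rule nn_integral_mono)
    fix x :: real
    let ?d = "std_normal_density x" and ?w = "if t \<le> \<bar>x\<bar> then 1 / 2 else 1 :: real"
      and ?k = "indicator {t..} x :: real"
    have gen: "ennreal d * ennreal w + ennreal h * (ennreal d * ennreal k) = ennreal (d * w + h * (d * k))"
      if "0 \<le> d" "0 \<le> w" "0 \<le> h" "0 \<le> k" for d w h k
      using that by (subst ennreal_plus; simp add: ennreal_mult)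
    have nn: "0 \<le> (1 / 2 :: real)" "0 \<le> ?d" "0 \<le> ?w" "0 \<le> ?k" by auto
    have "ennreal ?d * ennreal ?w + ennreal (1 / 2) * (ennreal ?d * indicator {t..} x)
        = ennreal ?d * ennreal ?w + ennreal (1 / 2) * (ennreal ?d * ennreal ?k)"
      by (simp add: indicator_def)
    also have "\<dots> = ennreal (?d * ?w + 1 / 2 * (?d * ?k))"
      by (rule gen[OF nn(2,3,1,4)])
    also have "\<dots> \<le> ennreal ?d" by (intro ennreal_leI) (auto simp: indicator_def)
    finally show "ennreal ?d * ennreal ?w + ennreal (1 / 2) * (ennreal ?d * indicator {t..} x) \<le> ennreal ?d" .
  qed
  finally have *: "?I + ennreal (?q / 2) \<le> 1" by (simp add: nn_integral_normal_density)
  have "?I \<le> 1" by (rule order_trans[OF _ *]) simp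
  then obtain y where y: "?I = ennreal y" "0 \<le> y" by (cases ?I) (auto simp: top_unique)
  have "ennreal (y + ?q / 2) \<le> ennreal 1" using * y by simp
  then have "y \<le> 1 - ?q / 2" by (simp flip: ennreal_1)
  also have "\<dots> \<le> exp (- (?q / 2))" using exp_ge_add_one_self[of "- (?q / 2)"] by simp
  finally have "y \<le> exp (- exp (- t\<^sup>2) / 14)" by simp
  then show ?thesis unfolding y by (rule ennreal_leI)
qed

text \<open>
  The superlevel sets of the order statistic are those of a sum of indicators.
\<close>
lemma borel_measurable_rearr:
  assumes X: "\<And>j. j \<in> {1..n} \<Longrightarrow> X j \<in> borel_measurable M" and i: "1 \<le> i" "i \<le> n"
  shows "(\<lambda>\<omega>. rearr n (\<lambda>j. X j \<omega>) i) \<in> borel_measurable M"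
proof -
  have [measurable]: "(\<lambda>\<omega>. X j \<omega>) \<in> borel_measurable M" if "j \<in> {1..n}" for j
    using X[OF that] .
  have card: "real (card {j \<in> {1..n}. c \<le> \<bar>X j \<omega>\<bar>}) = (\<Sum>j=1..n. if c \<le> \<bar>X j \<omega>\<bar> then 1 else 0)" for c \<omega>
    by (simp add: sum.If_cases Int_def)
  have "{\<omega> \<in> space M. c \<le> rearr n (\<lambda>j. X j \<omega>) i}
      = {\<omega> \<in> space M. real i \<le> (\<Sum>j=1..n. if c \<le> \<bar>X j \<omega>\<bar> then 1 else 0)}" for c
    unfolding rearr_ge_iff[OF i] card[symmetric] by simp
  moreover have "{\<omega> \<in> space M. real i \<le> (\<Sum>j=1..n. if c \<le> \<bar>X j \<omega>\<bar> then 1 else 0)} \<in> sets M" for c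
    by measurable
  ultimately show ?thesis by (subst borel_measurable_iff_ge) auto
qed

text \<open>
  If the order statistic is below \<open>t\<close>, then fewer than \<open>J\<close> coordinates exceed \<open>t\<close>, although at least
  \<open>6 * J\<close> are expected to. With \<open>N\<close> the number of exceedances, Markov's inequality for
  \<open>2 powr - N\<close>, whose expectation factorises, bounds this by \<open>2 ^ J * exp (- 3 * J) \<le> exp (- 2)\<close>.
\<close>
lemma prob_rearr_less:
  assumes N: "std_normal_vector M n X" and J: "1 \<le> J" "J \<le> n" and t: "0 \<le> t"
    and large: "6 * real J \<le> real n * (exp (- t\<^sup>2) / 7)"
  shows "measure M {\<omega> \<in> space M. rearr n (\<lambda>j. X j \<omega>) J < t} < 1 / 2"
proof -
  interpret prob_space M by (rule std_normal_vectorD[OF N])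
  have [measurable]: "(\<lambda>\<omega>. X i \<omega>) \<in> borel_measurable M" if "i \<in> {1..n}" for i
    using std_normal_vectorD(4)[OF N that] .
  let ?g = "\<lambda>x. if t \<le> \<bar>x\<bar> then 1 / 2 else 1 :: real"
  have "emeasure M {\<omega> \<in> space M. rearr n (\<lambda>j. X j \<omega>) J < t}
      \<le> emeasure M {\<omega> \<in> space M. 1 \<le> ennreal (2 ^ J) * (\<Prod>i=1..n. ennreal (?g (X i \<omega>)))}"
  proof (rule emeasure_mono)
    have "1 \<le> ennreal (2 ^ J) * (\<Prod>i=1..n. ennreal (?g (X i \<omega>)))"
      if "rearr n (\<lambda>j. X j \<omega>) J < t" for \<omega>
    proof -
      have "card {j \<in> {1..n}. t \<le> \<bar>X j \<omega>\<bar>} \<le> J"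
        using that rearr_ge_iff[OF J, of t "\<lambda>j. X j \<omega>"] by simp
      then have "(2::real) ^ card {j \<in> {1..n}. t \<le> \<bar>X j \<omega>\<bar>} \<le> 2 ^ J" by (intro power_increasing) auto
      moreover have "(\<Prod>i=1..n. ?g (X i \<omega>)) = 1 / 2 ^ card {j \<in> {1..n}. t \<le> \<bar>X j \<omega>\<bar>}"
        by (simp add: prod.If_cases Int_def power_one_over)
      ultimately have "1 \<le> 2 ^ J * (\<Prod>i=1..n. ?g (X i \<omega>))" by simp
      then show ?thesis by (simp add: prod_ennreal prod_nonneg flip: ennreal_mult)
    qed
    then show "{\<omega> \<in> space M. rearr n (\<lambda>j. X j \<omega>) J < t}
        \<subseteq> {\<omega> \<in> space M. 1 \<le> ennreal (2 ^ J) * (\<Prod>i=1..n. ennreal (?g (X i \<omega>)))}" by auto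
  qed measurable
  also have "\<dots> \<le> ennreal (2 ^ J) * (\<integral>\<^sup>+\<omega>. (\<Prod>i=1..n. ennreal (?g (X i \<omega>))) * indicator (space M) \<omega> \<partial>M)"
    by (rule nn_integral_Markov_inequality) auto
  also have "(\<integral>\<^sup>+\<omega>. (\<Prod>i=1..n. ennreal (?g (X i \<omega>))) * indicator (space M) \<omega> \<partial>M)
      = (\<integral>\<^sup>+\<omega>. (\<Prod>i=1..n. ennreal (?g (X i \<omega>))) \<partial>M)"
    by (intro nn_integral_cong) auto
  also have "\<dots> = (\<integral>\<^sup>+x. ennreal (std_normal_density x) * ennreal (?g x) \<partial>lborel) ^ n"
    by (rule nn_integral_prod_coordinates[OF N]) measurable
  also have "\<dots> \<le> ennreal (exp (- exp (- t\<^sup>2) / 14)) ^ n"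
    by (intro power_mono nn_integral_half_tail_le t) auto
  finally have "emeasure M {\<omega> \<in> space M. rearr n (\<lambda>j. X j \<omega>) J < t}
      \<le> ennreal (2 ^ J) * ennreal (exp (- exp (- t\<^sup>2) / 14)) ^ n" by (simp add: mult_left_mono)
  then have "prob {\<omega> \<in> space M. rearr n (\<lambda>j. X j \<omega>) J < t} \<le> 2 ^ J * exp (- exp (- t\<^sup>2) / 14) ^ n"
    by (simp add: emeasure_eq_measure ennreal_power flip: ennreal_mult)
  also have "exp (- exp (- t\<^sup>2) / 14) ^ n \<le> exp (- 3 * real J)"
    using large by (simp flip: exp_of_nat_mult)
  also have "(2::real) ^ J \<le> exp 1 ^ J" using exp_ge_add_one_self[of "1::real"] by (intro power_mono) auto
  also have "exp 1 ^ J * exp (- 3 * real J) = exp (- 2 * real J)"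
    by (simp flip: exp_of_nat_mult exp_add)
  also have "\<dots> \<le> exp (- 2)" using J by simp
  also have "exp (- 2 :: real) < 1 / 2"
  proof -
    have "2 < exp (2::real)" using exp_ge_add_one_self[of "2::real"] by linarith
    then show ?thesis by (simp add: exp_minus field_simps)
  qed
  finally show ?thesis by simp
qed

lemma prob_abs_coordinate_small:
  assumes N: "std_normal_vector M n X" and i: "i \<in> {1..n}"
  shows "measure M {\<omega> \<in> space M. \<bar>X i \<omega>\<bar> < 1 / 2} < 1 / 2"
proof -
  interpret prob_space M by (rule std_normal_vectorD[OF N])
  note [measurable] = std_normal_vectorD(4)[OF N i]
  have bound: "std_normal_density x \<le> 2 / 5" for x
  proof -
    have "sqrt (2.5\<^sup>2) \<le> sqrt (2 * pi)"
      using pi_approx by (intro real_sqrt_le_mono) (simp add: power2_eq_square)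
    then have "5 / 2 \<le> sqrt (2 * pi)" by simp
    then have "1 / sqrt (2 * pi) \<le> 1 / (5 / 2)" by (intro divide_left_mono) auto
    then have "1 / sqrt (2 * pi) \<le> 2 / 5" by simp
    moreover have "exp (- x\<^sup>2 / 2) / sqrt (2 * pi) \<le> 1 / sqrt (2 * pi)" by (intro divide_right_mono) auto
    moreover have "std_normal_density x = exp (- x\<^sup>2 / 2) / sqrt (2 * pi)"
      by (simp add: normal_density_def)
    ultimately show ?thesis by linarith
  qed
  have "emeasure M {\<omega> \<in> space M. \<bar>X i \<omega>\<bar> < 1 / 2} = (\<integral>\<^sup>+\<omega>. indicator {\<omega> \<in> space M. \<bar>X i \<omega>\<bar> < 1 / 2} \<omega> \<partial>M)"
    by (intro nn_integral_indicator[symmetric]) measurable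
  also have "\<dots> = (\<integral>\<^sup>+\<omega>. indicator {- 1 / 2..1 / 2} (X i \<omega>) * indicator {x. \<bar>x\<bar> < 1 / 2} (X i \<omega>) \<partial>M)"
    by (intro nn_integral_cong) (auto simp: indicator_def)
  also have "\<dots> \<le> (\<integral>\<^sup>+\<omega>. indicator {- 1 / 2..1 / 2} (X i \<omega>) \<partial>M)"
    by (intro nn_integral_mono) (auto simp: indicator_def)
  also have "\<dots> = (\<integral>\<^sup>+x. ennreal (std_normal_density x) * indicator {- 1 / 2..1 / 2} x \<partial>lborel)"
    by (intro nn_integral_coordinate[OF N i]) measurable
  also have "\<dots> \<le> (\<integral>\<^sup>+x. ennreal (2 / 5) * indicator {- 1 / 2..1 / 2 :: real} x \<partial>lborel)"
    using bound by (intro nn_integral_mono mult_right_mono ennreal_leI) auto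
  also have "\<dots> = ennreal (2 / 5)"
    by (subst nn_integral_cmult_indicator) auto
  finally show ?thesis by (simp add: emeasure_eq_measure)
qed

section \<open>The median\<close>

text \<open>
  An event of probability strictly below \<open>1 / 2\<close> contains neither of the two events that define a median.
\<close>
lemma median_leI:
  assumes "prob_space M" "is_median M Y m" "A \<in> sets M" "measure M A < 1 / 2"
    and Y: "\<And>\<omega>. \<omega> \<in> space M - A \<Longrightarrow> Y \<omega> \<le> K"
  shows "m \<le> K"
proof (rule ccontr)
  interpret prob_space M by fact
  assume "\<not> m \<le> K"
  then have "{\<omega> \<in> space M. Y \<omega> \<ge> m} \<subseteq> A" using Y by force
  then have "prob {\<omega> \<in> space M. Y \<omega> \<ge> m} \<le> prob A" using assms(3) by (rule finite_measure_mono)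
  then show False using assms(2,4) by (simp add: is_median_def)
qed

lemma median_geI:
  assumes "prob_space M" "is_median M Y m" "A \<in> sets M" "measure M A < 1 / 2"
    and Y: "\<And>\<omega>. \<omega> \<in> space M - A \<Longrightarrow> K \<le> Y \<omega>"
  shows "K \<le> m"
proof (rule ccontr)
  interpret prob_space M by fact
  assume "\<not> K \<le> m"
  then have "{\<omega> \<in> space M. Y \<omega> \<le> m} \<subseteq> A" using Y by force
  then have "prob {\<omega> \<in> space M. Y \<omega> \<le> m} \<le> prob A" using assms(3) by (rule finite_measure_mono)
  then show False using assms(2,4) by (simp add: is_median_def)
qed

lemma median_rearr_sum_le:
  assumes N: "std_normal_vector M n X" and n: "n \<ge> 1" and p: "1 \<le> p" "p \<le> 2"
    and m: "is_median M (\<lambda>\<omega>. rearr_sum n r p (\<lambda>i. X i \<omega>)) m"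
  shows "m \<le> 16 * (\<Sum>i=1..n. real i powr (- 2 * r) * (1 + ln (real n / real i)) powr (p - 1))"
proof (rule median_leI[OF std_normal_vectorD(1)[OF N] m prob_mean_exp_square_ge_4(2,1)[OF N n]])
  fix \<omega> assume "\<omega> \<in> space M - {\<omega> \<in> space M. 4 \<le> (\<Sum>i=1..n. exp ((X i \<omega>)\<^sup>2 / 4)) / real n}"
  then have "(\<Sum>i=1..n. exp ((X i \<omega>)\<^sup>2 / 4)) / real n \<le> 4" by auto
  then show "rearr_sum n r p (\<lambda>i. X i \<omega>)
      \<le> 16 * (\<Sum>i=1..n. real i powr (- 2 * r) * (1 + ln (real n / real i)) powr (p - 1))"
    using p by (intro rearr_sum_le) auto
qed

text \<open>
  At level \<open>t = sqrt (\<kappa> / 2)\<close> the expected number of exceedances is at least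
  \<open>n * exp (- \<kappa> / 2) / 7\<close>, which is \<open>exp (\<kappa> / 2) / 7 \<ge> 6\<close> times the index \<open>J \<le> n * exp (- \<kappa>)\<close>.
\<close>
lemma median_rearr_sum_ge:
  assumes N: "std_normal_vector M n X" and n: "n \<ge> 1" and p: "1 \<le> p"
    and \<kappa>: "8 \<le> \<kappa>" "\<kappa> \<le> ln (real n) / 2"
    and m: "is_median M (\<lambda>\<omega>. rearr_sum n r p (\<lambda>i. X i \<omega>)) m"
  shows "(\<kappa> / 2) powr (p - 1) * (\<Sum>i=1..nat \<lfloor>real n * exp (- \<kappa>)\<rfloor>. real i powr (- 2 * r)) \<le> m"
proof -
  define J where "J = nat \<lfloor>real n * exp (- \<kappa>)\<rfloor>"
  define t where "t = sqrt (\<kappa> / 2)"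
  have J: "1 \<le> J" "J \<le> n" "real J \<le> real n * exp (- \<kappa>)"
    unfolding J_def using partial_sum_ge(1-3)[OF n _ \<kappa>(2)] \<kappa>(1) by auto
  have t: "0 \<le> t" "t\<^sup>2 = \<kappa> / 2" using \<kappa> by (auto simp: t_def)
  \<comment> \<open>The eighth power is needed: the quadratic Taylor bound at \<open>4\<close> itself falls short of \<open>42\<close>.\<close>
  have "(13 / 8) ^ 8 \<le> exp (1 / 2 :: real) ^ 8"
    using exp_lower_Taylor_quadratic[of "1 / 2 :: real"] by (intro power_mono) (auto simp: power2_eq_square)
  also have "\<dots> = exp (4 :: real)" by (simp flip: exp_of_nat_mult)
  also have "\<dots> \<le> exp (\<kappa> / 2)" using \<kappa> by simp
  finally have "42 \<le> exp (\<kappa> / 2)" by (simp add: power_divide)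
  then have "exp (- \<kappa>) * 42 \<le> exp (- \<kappa>) * exp (\<kappa> / 2)" by (intro mult_left_mono) auto
  also have "\<dots> = exp (- (\<kappa> / 2))" by (simp flip: exp_add)
  finally have "real n * (exp (- \<kappa>) * 42) \<le> real n * exp (- (\<kappa> / 2))" by (intro mult_left_mono) auto
  then have large: "6 * real J \<le> real n * (exp (- t\<^sup>2) / 7)" 
    unfolding t(2) using J(3) by linarith
  let ?A = "{\<omega> \<in> space M. rearr n (\<lambda>j. X j \<omega>) J < t}"
  have "(\<lambda>\<omega>. rearr n (\<lambda>j. X j \<omega>) J) \<in> borel_measurable M"

    by (rule borel_measurable_rearr[OF std_normal_vectorD(4)[OF N] J(1,2)])
  then have A: "?A \<in> sets M" by measurable
  have "t powr (2 * (p - 1)) * (\<Sum>i=1..J. real i powr (- 2 * r)) \<le> m"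
  proof (rule median_geI[OF std_normal_vectorD(1)[OF N] m A prob_rearr_less[OF N J(1,2) t(1) large]])
    fix \<omega> assume "\<omega> \<in> space M - ?A"
    then have "t \<le> rearr n (\<lambda>j. X j \<omega>) J" by auto
    then show "t powr (2 * (p - 1)) * (\<Sum>i=1..J. real i powr (- 2 * r)) \<le> rearr_sum n r p (\<lambda>i. X i \<omega>)"
      using rearr_sum_ge[OF p J(1,2) t(1)] by blast
  qed
  also have "t powr (2 * (p - 1)) = (\<kappa> / 2) powr (p - 1)" 
    by (simp only: square_powr[OF t(1)] t(2))
  finally show ?thesis by (simp add: J_def)
qed

text \<open>
  This settles the dimensions \<open>n < exp 16\<close>: there the claimed order of magnitude is at most
  \<open>256 * exp 16\<close>, whence the constant \<open>exp (- 16) / 512\<close> below.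
\<close>
lemma median_rearr_sum_ge_half:
  assumes N: "std_normal_vector M n X" and n: "n \<ge> 1" and p: "1 \<le> p" "p \<le> 3 / 2"
    and m: "is_median M (\<lambda>\<omega>. rearr_sum n r p (\<lambda>i. X i \<omega>)) m"
  shows "1 / 2 \<le> m"
proof -
  have 1: "1 \<in> {1..n}" using n by simp
  note [measurable] = std_normal_vectorD(4)[OF N 1]
  have A: "{\<omega> \<in> space M. \<bar>X 1 \<omega>\<bar> < 1 / 2} \<in> sets M" by measurable
  have "(1 / 2) powr 1 \<le> (1 / 2 :: real) powr (2 * (p - 1))" using p by (intro powr_mono') auto
  also have "\<dots> \<le> m"
  proof (rule median_geI[OF std_normal_vectorD(1)[OF N] m A prob_abs_coordinate_small[OF N 1]])
    fix \<omega> assume "\<omega> \<in> space M - {\<omega> \<in> space M. \<bar>X 1 \<omega>\<bar> < 1 / 2}"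
    then have "1 / 2 \<le> rearr n (\<lambda>i. X i \<omega>) 1"
      using abs_le_rearr_1[OF 1, of "\<lambda>i. X i \<omega>"] by auto
    then show "(1 / 2) powr (2 * (p - 1)) \<le> rearr_sum n r p (\<lambda>i. X i \<omega>)"
      using rearr_sum_ge[OF p(1), of 1 n "1 / 2" "\<lambda>i. X i \<omega>" r] n by simp
  qed
  finally show ?thesis by simp
qed

lemma powr_div4_ge:
  assumes "0 \<le> x" "0 \<le> \<theta>" "\<theta> \<le> 1"
  shows "x powr \<theta> / 4 \<le> (x / 4) powr (\<theta> :: real)"
proof -
  have "4 powr \<theta> \<le> (4 :: real) powr 1" using assms by (intro powr_mono) auto
  then have "x powr \<theta> / 4 \<le> x powr \<theta> / 4 powr \<theta>" by (intro divide_left_mono) auto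
  then show ?thesis using assms by (simp add: powr_divide)
qed

text \<open>
  The indices that matter have \<open>ln (n / i)\<close> of the order of \<open>R \<approx> min (ln n) (1 / a)\<close>. Cutting at
  \<open>\<kappa> = max 8 (R / 2)\<close> gives \<open>\<kappa> \<ge> R / 2\<close>, while \<open>a * \<kappa> \<le> 8\<close> because
  \<open>a * R \<le> 1\<close>, so that a fixed proportion of the sum survives.
\<close>
lemma median_rearr_sum_ge_nonneg:
  assumes N: "std_normal_vector M n X" and n: "n \<ge> 3" and p: "1 \<le> p" "p \<le> 3 / 2"
    and a: "0 \<le> 1 - 2 * r" "1 - 2 * r \<le> 1"
    and m: "is_median M (\<lambda>\<omega>. rearr_sum n r p (\<lambda>i. X i \<omega>)) m"
  defines "L \<equiv> ln (real n)"
  shows "exp (- 16) / 512 * real n powr (1 - 2 * r) * (L / (1 + (1 - 2 * r) * L)) powr p \<le> m"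
proof -
  define a where "a = 1 - 2 * r"
  define R where "R = L / (1 + a * L)"
  have a01: "0 \<le> a" "a \<le> 1" using a by (auto simp: a_def)
  have L: "1 \<le> L" unfolding L_def by (rule ln_ge_1[OF n])
  have aL: "0 \<le> a * L" using a01 L by simp
  have R: "0 < R" "R \<le> L" "a * R \<le> 1" unfolding R_def using L aL by (auto simp: field_simps)
  have "exp (- 16) / 512 * real n powr a * R powr p \<le> m"
  proof (cases "16 \<le> L")
    case True
    define \<kappa> where "\<kappa> = max 8 (R / 2)"
    have \<kappa>: "8 \<le> \<kappa>" "\<kappa> \<le> ln (real n) / 2" "R / 2 \<le> \<kappa>" "0 \<le> \<kappa>" using R True by (auto simp: \<kappa>_def L_def)
    have "a * \<kappa> \<le> 8"
    proof (cases "R / 2 \<le> 8")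
      case True
      then show ?thesis using a01 by (simp add: \<kappa>_def)
    next
      case False
      then show ?thesis using R by (simp add: \<kappa>_def)
    qed
    then have e: "exp (- 8) \<le> exp (- a * \<kappa>)" by simp
    have "R powr (p - 1) / 4 \<le> (R / 4) powr (p - 1)" using R p by (intro powr_div4_ge) auto
    also have "\<dots> \<le> (\<kappa> / 2) powr (p - 1)" using R p \<kappa> by (intro powr_mono2) auto
    finally have k: "R powr (p - 1) / 4 \<le> (\<kappa> / 2) powr (p - 1)" .
    have "real n powr a * exp (- 8) * (R / 2) \<le> real n powr a * exp (- a * \<kappa>) * (R / 2)"
      using e R by (intro mult_left_mono mult_right_mono) auto
    also have "\<dots> \<le> (\<Sum>i=1..nat \<lfloor>real n * exp (- \<kappa>)\<rfloor>. real i powr (a - 1))"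
      using partial_sum_ge(4)[OF _ \<kappa>(4,2) a01] n by (simp add: R_def L_def)
    finally have S: "real n powr a * exp (- 8) * (R / 2) \<le> (\<Sum>i=1..nat \<lfloor>real n * exp (- \<kappa>)\<rfloor>. real i powr (a - 1))" .
    have "R powr (p - 1) / 4 * (real n powr a * exp (- 8) * (R / 2))
        \<le> (\<kappa> / 2) powr (p - 1) * (\<Sum>i=1..nat \<lfloor>real n * exp (- \<kappa>)\<rfloor>. real i powr (a - 1))"
      using k S R by (intro mult_mono) auto
    also have "\<dots> \<le> m" using median_rearr_sum_ge[OF N _ p(1) \<kappa>(1,2) m] n by (simp add: a_def)
    also have "R powr (p - 1) / 4 * (real n powr a * exp (- 8) * (R / 2))
        = exp (- 8) / 8 * real n powr a * (R powr (p - 1) * R powr 1)" using R by simp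
    also have "R powr (p - 1) * R powr 1 = R powr p" by (subst powr_add[symmetric]) simp
    finally have "exp (- 8) / 8 * real n powr a * R powr p \<le> m" .
    moreover have "exp (- 16) / 512 * real n powr a * R powr p \<le> exp (- 8) / 8 * real n powr a * R powr p"
      by (intro mult_right_mono frac_le) auto
    ultimately show ?thesis by linarith
  next
    case False
    have "real n powr a \<le> real n powr 1" using n a01 by (intro powr_mono) auto
    also have "\<dots> = exp L" using n by (simp add: L_def)
    also have "\<dots> \<le> exp 16" using False by simp
    finally have 1: "real n powr a \<le> exp 16" .
    have "R powr p \<le> 16 powr p" using R False p by (intro powr_mono2) auto
    also have "\<dots> \<le> 16 powr 2" using p by (intro powr_mono) auto
    finally have "R powr p \<le> 256" by simp
    then have "real n powr a * R powr p \<le> exp 16 * 256" using 1 by (intro mult_mono) auto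
    then have "exp (- 16) / 512 * (real n powr a * R powr p) \<le> exp (- 16) / 512 * (exp 16 * 256)"
      by (intro mult_left_mono) auto
    also have "\<dots> = 1 / 2" by (simp add: exp_minus)
    also have "\<dots> \<le> m" using median_rearr_sum_ge_half[OF N _ p m] n by simp
    finally show ?thesis by (simp add: mult.assoc)
  qed
  then show ?thesis by (simp add: a_def R_def)
qed

text \<open>
  The indices up to \<open>sqrt n\<close> carry a fixed proportion of the sum, so the cut-off may be \<open>sqrt n\<close>, that is \<open>\<kappa> = L / 2\<close>.
\<close>
lemma median_rearr_sum_ge_nonpos:
  assumes N: "std_normal_vector M n X" and n: "n \<ge> 3" and p: "1 \<le> p" "p \<le> 3 / 2"
    and b: "0 \<le> 2 * r - 1"
    and m: "is_median M (\<lambda>\<omega>. rearr_sum n r p (\<lambda>i. X i \<omega>)) m"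
  defines "L \<equiv> ln (real n)"
  shows "exp (- 16) / 512 * L powr (p - 1) * (L / (1 + (2 * r - 1) * L)) \<le> m"
proof -
  define b where "b = 2 * r - 1"
  define R where "R = L / (1 + b * L)"
  have b0: "0 \<le> b" using b by (auto simp: b_def)
  have L: "1 \<le> L" unfolding L_def by (rule ln_ge_1[OF n])
  have bL: "0 \<le> b * L" using b0 L by simp
  have R: "0 < R" "R \<le> L" unfolding R_def using L bL by (auto simp: field_simps)
  have "exp (- 16) / 512 * L powr (p - 1) * R \<le> m"
  proof (cases "16 \<le> L")
    case True
    define \<kappa> where "\<kappa> = L / 2"
    have \<kappa>: "8 \<le> \<kappa>" "\<kappa> \<le> ln (real n) / 2" "0 \<le> \<kappa>" using True by (auto simp: \<kappa>_def L_def)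
    have "L powr (p - 1) / 4 \<le> (L / 4) powr (p - 1)" using L p by (intro powr_div4_ge) auto
    then have k: "L powr (p - 1) / 4 \<le> (\<kappa> / 2) powr (p - 1)" by (simp add: \<kappa>_def)
    have S: "R / 2 \<le> (\<Sum>i=1..nat \<lfloor>real n * exp (- \<kappa>)\<rfloor>. real i powr (- b - 1))"
      using partial_sum_ge(5)[OF _ \<kappa>(3,2) b0] n by (simp add: R_def L_def)
    have "L powr (p - 1) / 4 * (R / 2)
        \<le> (\<kappa> / 2) powr (p - 1) * (\<Sum>i=1..nat \<lfloor>real n * exp (- \<kappa>)\<rfloor>. real i powr (- b - 1))"
      using k S R by (intro mult_mono) auto
    also have "\<dots> \<le> m" using median_rearr_sum_ge[OF N _ p(1) \<kappa>(1,2) m] n by (simp add: b_def)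
    also have "L powr (p - 1) / 4 * (R / 2) = 1 / 8 * (L powr (p - 1) * R)" by simp
    finally have "1 / 8 * (L powr (p - 1) * R) \<le> m" .
    moreover have "exp (- 16) / 512 * (L powr (p - 1) * R) \<le> 1 / 8 * (L powr (p - 1) * R)"
      using R by (intro mult_right_mono frac_le mult_nonneg_nonneg) auto
    ultimately have "exp (- 16) / 512 * (L powr (p - 1) * R) \<le> m" by (rule order_trans[rotated])
    then show ?thesis by (simp only: mult.assoc)
  next
    case False
    have "L powr (p - 1) \<le> L powr 1" using L p by (intro powr_mono) auto
    then have "L powr (p - 1) * R \<le> 16 * 16" using R False L by (intro mult_mono) auto
    moreover have "exp (- 16) / 512 \<le> (1 / 512 :: real)" by simp
    ultimately have "exp (- 16) / 512 * (L powr (p - 1) * R) \<le> 1 / 512 * (16 * 16)"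
      using R by - (rule mult_mono, auto)
    also have "\<dots> \<le> m" using median_rearr_sum_ge_half[OF N _ p m] n by simp
    finally show ?thesis by (simp add: mult.assoc)
  qed
  then show ?thesis by (simp add: b_def R_def)
qed

lemma median_rearr_sum_bounds:
  fixes n :: nat and p r m :: real and M :: "'a measure" and X :: "nat \<Rightarrow> 'a \<Rightarrow> real"
  assumes n: "n \<ge> 3" and p: "1 < p" "p < 3 / 2" and r: "0 \<le> r" "r \<le> 2"
    and N: "std_normal_vector M n X"
    and m: "is_median M (\<lambda>\<omega>. rearr_sum n r p (\<lambda>i. X i \<omega>)) m"
  shows "r \<le> 1 / 2 \<Longrightarrow> m \<le> 448 * real n powr (1 - 2 * r) * ln (real n) powr p * (1 + (1 - 2 * r) * ln (real n)) powr (- p)"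
    and "r \<le> 1 / 2 \<Longrightarrow> m \<ge> exp (- 16) / 512 * real n powr (1 - 2 * r) * ln (real n) powr p * (1 + (1 - 2 * r) * ln (real n)) powr (- p)"
    and "1 / 2 \<le> r \<Longrightarrow> m \<le> 448 * ln (real n) powr p * inverse (1 + (2 * r - 1) * ln (real n))"
    and "1 / 2 \<le> r \<Longrightarrow> m \<ge> exp (- 16) / 512 * ln (real n) powr p * inverse (1 + (2 * r - 1) * ln (real n))"
proof -
  let ?L = "ln (real n)"
  have L: "1 \<le> ?L" by (rule ln_ge_1[OF n])
  have p': "1 \<le> p" "p \<le> 2" "p \<le> 3 / 2" and n1: "n \<ge> 1" using p n by auto
  note up = median_rearr_sum_le[OF N n1 p'(1,2) m]
  have quot: "x * ?L powr p * (1 + (1 - 2 * r) * ?L) powr (- p) = x * (?L / (1 + (1 - 2 * r) * ?L)) powr p"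
    if "r \<le> 1 / 2" for x
  proof -
    have "0 \<le> (1 - 2 * r) * ?L" using that L by simp
    then show ?thesis using L by (simp add: powr_divide powr_minus field_simps)
  qed
  have Lp: "?L powr (p - 1) * ?L = ?L powr p"
  proof -
    have "?L powr (p - 1) * ?L powr 1 = ?L powr p" by (subst powr_add[symmetric]) simp
    then show ?thesis using L by simp
  qed
  { assume r2: "r \<le> 1 / 2"
    have "m \<le> 16 * (28 * real n powr (1 - 2 * r) * (?L / (1 + (1 - 2 * r) * ?L)) powr (p - 1 + 1))"
      using up log_sum_le_nonneg[of "1 - 2 * r" n "p - 1"] r r2 n p by simp
    then show "m \<le> 448 * real n powr (1 - 2 * r) * ?L powr p * (1 + (1 - 2 * r) * ?L) powr (- p)"
      unfolding quot[OF r2] by simp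
    show "m \<ge> exp (- 16) / 512 * real n powr (1 - 2 * r) * ?L powr p * (1 + (1 - 2 * r) * ?L) powr (- p)"
      unfolding quot[OF r2] using median_rearr_sum_ge_nonneg[OF N n p'(1,3) _ _ m] r r2 by simp }
  { assume r2: "1 / 2 \<le> r"
    have "m \<le> 16 * (16 * ?L powr (p - 1) * (?L / (1 + (2 * r - 1) * ?L)))"
      using up log_sum_le_nonpos[of "2 * r - 1" n "p - 1"] r r2 n p by simp
    also have "\<dots> = 256 * (?L powr p * inverse (1 + (2 * r - 1) * ?L))"
      unfolding Lp[symmetric] by (simp add: field_simps)
    also have "\<dots> \<le> 448 * (?L powr p * inverse (1 + (2 * r - 1) * ?L))"
      using r2 L by (intro mult_right_mono mult_nonneg_nonneg) (auto intro!: add_nonneg_nonneg mult_nonneg_nonneg)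
    finally show "m \<le> 448 * ?L powr p * inverse (1 + (2 * r - 1) * ?L)" by (simp add: mult.assoc)
    have "exp (- 16) / 512 * ?L powr (p - 1) * (?L / (1 + (2 * r - 1) * ?L)) \<le> m"
      using median_rearr_sum_ge_nonpos[OF N n p'(1,3) _ m] r2 by simp
    then show "m \<ge> exp (- 16) / 512 * ?L powr p * inverse (1 + (2 * r - 1) * ?L)"
      unfolding Lp[symmetric] by (simp add: field_simps) }
qed

section \<open>The rearranged sum on Euclidean balls\<close>

text \<open>
  With \<open>\<beta> = 2 * r / (2 - p)\<close>, the power \<open>weight_sum n \<beta> powr (2 - p)\<close> is the maximum of the rearranged sum
  over the Euclidean unit sphere.
\<close>
definition weight_sum :: "nat \<Rightarrow> real \<Rightarrow> real" where
  "weight_sum n \<beta> = (\<Sum>i=1..n. real i powr (- \<beta>))"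

lemma weight_sum_ge_1:
  assumes "n \<ge> 1"
  shows "1 \<le> weight_sum n \<beta>"
proof -
  have "(\<Sum>i\<in>{1}. real i powr (- \<beta>)) \<le> weight_sum n \<beta>"
    unfolding weight_sum_def using assms by (intro sum_mono2) auto
  then show ?thesis by simp
qed

text \<open>
  Hoelder's inequality for the exponents \<open>1 / (2 - p)\<close> and \<open>1 / (p - 1)\<close>, up to a factor 2. The
  weights \<open>w i\<close> are the squared coordinates of the extremal unit vector, and each power is
  linearised at \<open>w i * q\<close>, the value of its argument at the extremal vector of squared length \<open>q\<close>.
\<close>
lemma rearr_sum_le_weight_sum:
  fixes x :: "nat \<Rightarrow> real"
  assumes n: "n \<ge> 1" and p: "1 < p" "p < 2" and q: "0 < q" "(\<Sum>j=1..n. (x j)\<^sup>2) \<le> q"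
  shows "rearr_sum n r p x \<le> 2 * weight_sum n (2 * r / (2 - p)) powr (2 - p) * q powr (p - 1)"
proof -
  define \<beta> where "\<beta> = 2 * r / (2 - p)"
  define B where "B = weight_sum n \<beta>"
  define w where "w i = real i powr (- \<beta>) / B" for i
  have B: "1 \<le> B" unfolding B_def by (rule weight_sum_ge_1[OF n])
  have w: "0 < w i" if "i \<in> {1..n}" for i using that B by (simp add: w_def)
  have w1: "(\<Sum>i=1..n. w i) = 1"
    using B unfolding w_def sum_divide_distrib[symmetric] B_def weight_sum_def by simp
  have "rearr_sum n r p x \<le> (\<Sum>i=1..n. B powr (2 - p) * q powr (p - 1) * (w i + (rearr n x i)\<^sup>2 / q))"
    unfolding rearr_sum_def
  proof (rule sum_mono)
    fix i assume i: "i \<in> {1..n}"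
    let ?y = "(rearr n x i)\<^sup>2"
    have "real i powr (- 2 * r) = (B * w i) powr (2 - p)"
      using B p by (simp add: w_def powr_powr \<beta>_def)
    also have "\<dots> = B powr (2 - p) * w i powr (2 - p)" using B w[OF i] by (simp add: powr_mult)
    finally have e: "real i powr (- 2 * r) = B powr (2 - p) * w i powr (2 - p)" .
    have "rearr n x i powr (2 * (p - 1)) = ?y powr (p - 1)"
      using i by (intro square_powr rearr_nonneg) auto
    also have "\<dots> \<le> (w i * q) powr (p - 1) * (1 + ?y / (w i * q))"
      using w[OF i] q p by (intro powr_le_linear) auto
    finally have "real i powr (- 2 * r) * rearr n x i powr (2 * (p - 1))
        \<le> (B powr (2 - p) * w i powr (2 - p)) * ((w i * q) powr (p - 1) * (1 + ?y / (w i * q)))"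
      unfolding e by (intro mult_left_mono) auto
    also have "\<dots> = B powr (2 - p) * q powr (p - 1) * ((w i powr (2 - p) * w i powr (p - 1)) * (1 + ?y / (w i * q)))"
      using w[OF i] q by (simp add: powr_mult)
    also have "w i powr (2 - p) * w i powr (p - 1) = w i"
      using w[OF i] by (subst powr_add[symmetric]) simp
    also have "w i * (1 + ?y / (w i * q)) = w i + ?y / q" using w[OF i] q by (simp add: field_simps)
    finally show "real i powr (- 2 * r) * rearr n x i powr (2 * (p - 1))
        \<le> B powr (2 - p) * q powr (p - 1) * (w i + ?y / q)" .
  qed
  also have "\<dots> = B powr (2 - p) * q powr (p - 1) * (1 + (\<Sum>i=1..n. (rearr n x i)\<^sup>2) / q)"
    by (simp only: sum_distrib_left[symmetric] sum.distrib sum_divide_distrib[symmetric] w1)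
  also have "(\<Sum>i=1..n. (rearr n x i)\<^sup>2) = (\<Sum>j=1..n. (x j)\<^sup>2)"
    by (subst sum_rearr) simp
  also have "B powr (2 - p) * q powr (p - 1) * (1 + (\<Sum>j=1..n. (x j)\<^sup>2) / q)
      \<le> B powr (2 - p) * q powr (p - 1) * 2" using q by (intro mult_left_mono) auto
  finally show ?thesis by (simp add: B_def \<beta>_def mult_ac)
qed

text \<open>
  The extremal vector of squared length \<open>s\<close> has decreasing coordinates, so dominating it
  coordinatewise in modulus also dominates its order statistics.
\<close>
lemma rearr_sum_ge_extremal:
  fixes x :: "nat \<Rightarrow> real"
  assumes n: "n \<ge> 1" and p: "1 < p" "p < 2" and r: "0 \<le> r" and s: "0 \<le> s"
  defines "\<beta> \<equiv> 2 * r / (2 - p)"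
  assumes x: "\<And>i. i \<in> {1..n} \<Longrightarrow> sqrt (s * real i powr (- \<beta>) / weight_sum n \<beta>) \<le> \<bar>x i\<bar>"
  shows "s powr (p - 1) * weight_sum n \<beta> powr (2 - p) \<le> rearr_sum n r p x"
proof -
  define B where "B = weight_sum n \<beta>"
  define u where "u i = sqrt (s * real i powr (- \<beta>) / B)" for i
  have B: "1 \<le> B" unfolding B_def by (rule weight_sum_ge_1[OF n])
  have \<beta>: "0 \<le> \<beta>" using p r by (simp add: \<beta>_def)
  have "s powr (p - 1) * B powr (2 - p) = (\<Sum>i=1..n. real i powr (- \<beta>) * (s powr (p - 1) * B powr (1 - p)))"
  proof -
    have "B powr (2 - p) = B powr 1 * B powr (1 - p)" by (subst powr_add[symmetric]) simp
    then show ?thesis using B unfolding sum_distrib_right[symmetric] by (simp add: B_def weight_sum_def)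
  qed
  also have "\<dots> = (\<Sum>i=1..n. real i powr (- 2 * r) * u i powr (2 * (p - 1)))"
  proof (rule sum.cong[OF refl])
    fix i assume i: "i \<in> {1..n}"
    have nn: "0 \<le> s * real i powr (- \<beta>) / B" using s B by simp
    have "u i powr (2 * (p - 1)) = (s * real i powr (- \<beta>) / B) powr (p - 1)"
      unfolding u_def using nn by (subst square_powr) auto
    also have "\<dots> = s powr (p - 1) * B powr (1 - p) * real i powr (- \<beta> * (p - 1))"
    proof -
      have "B powr (1 - p) = inverse (B powr (p - 1))" by (subst powr_minus[symmetric]) simp
      then show ?thesis using s B by (simp add: powr_mult powr_divide powr_powr field_simps)
    qed
    finally have "real i powr (- 2 * r) * u i powr (2 * (p - 1))
        = (real i powr (- 2 * r) * real i powr (- \<beta> * (p - 1))) * (s powr (p - 1) * B powr (1 - p))" by simp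
    also have "real i powr (- 2 * r) * real i powr (- \<beta> * (p - 1)) = real i powr (- \<beta>)"
    proof -
      have "- 2 * r = - \<beta> * (2 - p)" using p by (simp add: \<beta>_def)
      then have "- 2 * r + - \<beta> * (p - 1) = - \<beta>" by (simp add: algebra_simps)
      then show ?thesis by (simp only: powr_add[symmetric])
    qed
    finally show "real i powr (- \<beta>) * (s powr (p - 1) * B powr (1 - p)) = real i powr (- 2 * r) * u i powr (2 * (p - 1))" ..
  qed
  also have "\<dots> \<le> rearr_sum n r p x"
    unfolding rearr_sum_def
  proof (intro sum_mono mult_left_mono powr_mono2)
    fix i assume i: "i \<in> {1..n}"
    show "0 \<le> u i" using s B by (simp add: u_def)
    show "u i \<le> rearr n x i"
    proof (rule antimono_bound_le_rearr)
      show "u j \<le> \<bar>x j\<bar>" if "j \<in> {1..n}" for j using x[OF that] by (simp add: u_def B_def)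
      show "u i \<le> u j" if "1 \<le> j" "j \<le> i" for j
        unfolding u_def using that s B \<beta>
        by (intro real_sqrt_le_mono divide_right_mono mult_left_mono powr_mono2') auto
    qed (use i in auto)
  qed (use p in auto)
  finally show ?thesis by (simp add: B_def)
qed

section \<open>The tail\<close>

lemma borel_measurable_rearr_sum:
  assumes "\<And>j. j \<in> {1..n} \<Longrightarrow> X j \<in> borel_measurable M"
  shows "(\<lambda>\<omega>. rearr_sum n r p (\<lambda>j. X j \<omega>)) \<in> borel_measurable M"
  unfolding rearr_sum_def
proof (rule borel_measurable_sum)
  fix i assume i: "i \<in> {1..n}"
  have [measurable]: "(\<lambda>\<omega>. rearr n (\<lambda>j. X j \<omega>) i) \<in> borel_measurable M"
    using i by (intro borel_measurable_rearr assms) auto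
  show "(\<lambda>\<omega>. real i powr (- 2 * r) * rearr n (\<lambda>j. X j \<omega>) i powr (2 * (p - 1))) \<in> borel_measurable M"
    by measurable
qed

text \<open>
  The rearranged sum is homogeneous of degree \<open>2 * (p - 1)\<close>, so it exceeds \<open>t\<close> only if
  \<open>|X|\<^sup>2\<close> is at least \<open>z / 2 powr \<gamma>\<close> with \<open>z = (t / B powr (2 - p)) powr \<gamma>\<close>, and it does exceed \<open>t\<close> on the
  box above an extremal vector of squared length \<open>2 * z\<close>. For \<open>t\<close> this large, \<open>z / 2 powr \<gamma>\<close> is at least
  \<open>8 * n\<close>, and the factors exponential in \<open>n\<close> that both estimates lose are absorbed into the constants
  \<open>8\<close> and \<open>4\<close>.
\<close>
lemma prob_rearr_sum_greater_bounds:
  fixes M :: "'a measure" and X :: "nat \<Rightarrow> 'a \<Rightarrow> real"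
  assumes N: "std_normal_vector M n X" and n: "n \<ge> 1" and p: "1 < p" "p < 2" and r: "0 \<le> r"
  defines "B \<equiv> weight_sum n (2 * r / (2 - p))" and "\<gamma> \<equiv> 1 / (p - 1)"
  assumes t: "t > 2 * B powr (2 - p) * (8 * real n) powr (p - 1)"
  shows "measure M {\<omega> \<in> space M. rearr_sum n r p (\<lambda>i. X i \<omega>) > t}
      \<le> 2 * exp (- (((1 / 2) powr \<gamma> / 8) * (t / B powr (2 - p)) powr \<gamma>))"
    and "measure M {\<omega> \<in> space M. rearr_sum n r p (\<lambda>i. X i \<omega>) > t}
      \<ge> 2 * exp (- (4 * (t / B powr (2 - p)) powr \<gamma>))"
proof -
  interpret prob_space M by (rule std_normal_vectorD[OF N])
  define \<beta> where "\<beta> = 2 * r / (2 - p)"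
  have B\<beta>: "B = weight_sum n \<beta>" by (simp add: B_def \<beta>_def)
  have meas[measurable]: "(\<lambda>\<omega>. X i \<omega>) \<in> borel_measurable M" if "i \<in> {1..n}" for i
    using std_normal_vectorD(4)[OF N that] .
  have B: "1 \<le> B" unfolding B_def by (rule weight_sum_ge_1[OF n])
  define T where "T = t / B powr (2 - p)"
  have \<gamma>: "0 < \<gamma>" "\<gamma> * (p - 1) = 1" using p by (auto simp: \<gamma>_def)
  have Tt: "T * B powr (2 - p) = t" using B by (simp add: T_def)
  have T: "2 * (8 * real n) powr (p - 1) < T" using t B by (simp add: T_def field_simps)
  have T0: "0 < T" by (rule le_less_trans[OF _ T]) auto
  have pow: "(8 * real n) \<le> y powr \<gamma>" if "(8 * real n) powr (p - 1) \<le> y" for y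
  proof -
    have "((8 * real n) powr (p - 1)) powr \<gamma> \<le> y powr \<gamma>" using that \<gamma> by (intro powr_mono2) auto
    then show ?thesis using \<gamma> n by (simp add: powr_powr mult.commute)
  qed
  define q where "q = (T / 2) powr \<gamma>"
  have q: "8 * real n \<le> q" unfolding q_def using T by (intro pow) auto
  have q0: "0 < q" using q n by (intro less_le_trans[OF _ q]) auto
  have "prob {\<omega> \<in> space M. rearr_sum n r p (\<lambda>i. X i \<omega>) > t} \<le> prob {\<omega> \<in> space M. q \<le> (\<Sum>i=1..n. (X i \<omega>)\<^sup>2)}"
  proof (rule finite_measure_mono)
    show "{\<omega> \<in> space M. rearr_sum n r p (\<lambda>i. X i \<omega>) > t} \<subseteq> {\<omega> \<in> space M. q \<le> (\<Sum>i=1..n. (X i \<omega>)\<^sup>2)}"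
    proof (intro subsetI CollectI conjI; clarify)
      fix \<omega> assume S: "t < rearr_sum n r p (\<lambda>i. X i \<omega>)"
      show "q \<le> (\<Sum>i=1..n. (X i \<omega>)\<^sup>2)"
      proof (rule ccontr)
        assume "\<not> ?thesis"
        then have "rearr_sum n r p (\<lambda>i. X i \<omega>) \<le> 2 * B powr (2 - p) * q powr (p - 1)"
          unfolding B_def using q0 by (intro rearr_sum_le_weight_sum n p) auto
        also have "q powr (p - 1) = T / 2" using \<gamma> T0 by (simp add: q_def powr_powr)
        finally show False using S Tt by (simp add: mult.commute)
      qed
    qed
    show "{\<omega> \<in> space M. q \<le> (\<Sum>i=1..n. (X i \<omega>)\<^sup>2)} \<in> events" by measurable
  qed
  also have "\<dots> \<le> sqrt 2 ^ n * exp (- q / 4)" by (rule prob_sum_squares_le[OF N])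
  also have "\<dots> \<le> exp (real n) * exp (- q / 4)"
  proof -
    have "sqrt 2 \<le> exp (1 :: real)" using sqrt2_less_2 exp_ge_add_one_self[of "1 :: real"] by linarith
    then have "sqrt 2 ^ n \<le> exp (1 :: real) ^ n" by (intro power_mono) auto
    then show ?thesis by (simp flip: exp_of_nat_mult)
  qed
  also have "\<dots> = exp (real n - q / 4)" by (simp flip: exp_add)
  also have "\<dots> \<le> exp (- (q / 8))" using q by simp
  also have "\<dots> \<le> 2 * exp (- (q / 8))" by simp
  also have "q / 8 = ((1 / 2) powr \<gamma> / 8) * T powr \<gamma>"
    using T0 powr_mult[of T "1 / 2" \<gamma>] by (simp add: q_def)
  finally show "measure M {\<omega> \<in> space M. rearr_sum n r p (\<lambda>i. X i \<omega>) > t}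
      \<le> 2 * exp (- (((1 / 2) powr \<gamma> / 8) * (t / B powr (2 - p)) powr \<gamma>))"
    by (simp add: T_def)
  \<comment> \<open>The factor 2 makes the extremal value strictly larger than \<open>t\<close>.\<close>
  define s where "s = 2 * T powr \<gamma>"
  have "8 * real n \<le> T powr \<gamma>" using T by (intro pow) (auto intro: order_trans[rotated, OF less_imp_le])
  then have s: "16 * real n \<le> s" by (simp add: s_def)
  have s0: "0 < s" using s n by (intro less_le_trans[OF _ s]) auto
  define u where "u i = sqrt (s * real i powr (- \<beta>) / B)" for i
  have u: "0 \<le> u i" for i using s0 B by (simp add: u_def)
  have "(\<Sum>i=1..n. (u i)\<^sup>2) = (\<Sum>i=1..n. s / B * real i powr (- \<beta>))"
    using s0 B by (intro sum.cong) (auto simp: u_def)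
  also have "\<dots> = s" unfolding sum_distrib_left[symmetric] using B by (simp add: B\<beta> weight_sum_def)
  finally have us: "(\<Sum>i=1..n. (u i)\<^sup>2) = s" .
  have "2 * 7 ^ n \<le> exp (s :: real)"
  proof -
    have "2 \<le> exp (1 :: real)" using exp_ge_add_one_self[of "1 :: real"] by simp
    then have "2 ^ (3 * n + 1) \<le> exp (1 :: real) ^ (3 * n + 1)" by (intro power_mono) auto
    also have "\<dots> = exp (3 * real n + 1)" by (simp add: exp_add exp_of_nat_mult[symmetric] add.commute mult.commute)
    also have "\<dots> \<le> exp s" using s n by simp
    finally have "2 * 8 ^ n \<le> exp s" by (simp add: power_mult)
    moreover have "(7 :: real) ^ n \<le> 8 ^ n" by (intro power_mono) auto
    ultimately show ?thesis by linarith
  qed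
  then have "2 * exp (- (2 * s)) \<le> exp (- s) / 7 ^ n"
  proof -
    assume *: "2 * 7 ^ n \<le> exp s"
    have "exp (- (2 * s)) * (2 * 7 ^ n) \<le> exp (- (2 * s)) * exp s" using * by (intro mult_left_mono) auto
    also have "\<dots> = exp (- s)" by (simp flip: exp_add)
    finally show ?thesis by (simp add: field_simps)
  qed
  also have "\<dots> \<le> prob {\<omega> \<in> space M. \<forall>i\<in>{1..n}. u i \<le> X i \<omega>}"
    using prob_box_ge[OF N n, of u] u by (simp only: us)
  also have "\<dots> \<le> prob {\<omega> \<in> space M. rearr_sum n r p (\<lambda>i. X i \<omega>) > t}"
  proof (rule finite_measure_mono)
    have [measurable]: "(\<lambda>\<omega>. rearr_sum n r p (\<lambda>j. X j \<omega>)) \<in> borel_measurable M"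
      by (rule borel_measurable_rearr_sum[OF std_normal_vectorD(4)[OF N]])
    show "{\<omega> \<in> space M. rearr_sum n r p (\<lambda>i. X i \<omega>) > t} \<in> events" by measurable
    show "{\<omega> \<in> space M. \<forall>i\<in>{1..n}. u i \<le> X i \<omega>} \<subseteq> {\<omega> \<in> space M. rearr_sum n r p (\<lambda>i. X i \<omega>) > t}"
    proof (intro subsetI CollectI conjI; clarify)
      fix \<omega> assume box: "\<forall>i\<in>{1..n}. u i \<le> X i \<omega>"
      have "1 < 2 powr (p - 1)" using p by simp
      then have "T * 1 < T * 2 powr (p - 1)" using T0 by (intro mult_strict_left_mono) auto
      also have "\<dots> = s powr (p - 1)" using \<gamma> T0 by (simp add: s_def powr_mult powr_powr)
      finally have "T * B powr (2 - p) < s powr (p - 1) * B powr (2 - p)" using B by simp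
      also have "\<dots> \<le> rearr_sum n r p (\<lambda>i. X i \<omega>)"
        unfolding B\<beta> \<beta>_def
      proof (rule rearr_sum_ge_extremal[OF n p r])
        show "0 \<le> s" using s0 by simp
        fix i assume "i \<in> {1..n}"
        then have "u i \<le> \<bar>X i \<omega>\<bar>" using box by force
        then show "sqrt (s * real i powr (- (2 * r / (2 - p))) / weight_sum n (2 * r / (2 - p))) \<le> \<bar>X i \<omega>\<bar>"
          by (simp add: u_def B\<beta> \<beta>_def)
      qed
      finally show "t < rearr_sum n r p (\<lambda>i. X i \<omega>)" by (simp add: Tt)
    qed
  qed
  finally show "measure M {\<omega> \<in> space M. rearr_sum n r p (\<lambda>i. X i \<omega>) > t}
      \<ge> 2 * exp (- (4 * (t / B powr (2 - p)) powr \<gamma>))"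
    by (simp add: s_def T_def)
qed

section \<open>The size of the weight sum\<close>

lemma weight_sum_bounds_less:
  assumes n: "n \<ge> 1" and \<beta>: "0 \<le> \<beta>" "\<beta> < 1"
  shows "real n powr (1 - \<beta>) \<le> weight_sum n \<beta>" and "weight_sum n \<beta> \<le> real n powr (1 - \<beta>) / (1 - \<beta>)"
proof -
  have "(\<Sum>i=1..n. real n powr (- \<beta>)) \<le> weight_sum n \<beta>"
    unfolding weight_sum_def using \<beta> by (intro sum_mono powr_mono2') auto
  moreover have "(\<Sum>i=1..n. real n powr (- \<beta>)) = real n powr 1 * real n powr (- \<beta>)" using n by simp
  moreover have "real n powr 1 * real n powr (- \<beta>) = real n powr (1 - \<beta>)" by (subst powr_add[symmetric]) simp
  ultimately show "real n powr (1 - \<beta>) \<le> weight_sum n \<beta>" by simp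
  show "weight_sum n \<beta> \<le> real n powr (1 - \<beta>) / (1 - \<beta>)"
    unfolding weight_sum_def using sum_powr_le_pos[of "1 - \<beta>" n] \<beta> n by simp
qed

lemma weight_sum_le_greater:
  assumes n: "n \<ge> 1" and \<beta>: "1 < \<beta>"
  shows "weight_sum n \<beta> \<le> 1 + 1 / (\<beta> - 1)"
  unfolding weight_sum_def using sum_powr_le_neg[of "\<beta> - 1" n] \<beta> n by simp

lemma weight_sum_bounds_1:
  assumes n: "n \<ge> 3"
  shows "ln (real n) \<le> weight_sum n 1" and "weight_sum n 1 \<le> 2 * ln (real n)"
proof -
  have "box_cox 0 (real n) \<le> box_cox 0 (real n + 1)" using n by (intro box_cox_mono) auto
  also have "\<dots> \<le> (\<Sum>i=1..n. real i powr (0 - 1))" by (rule sum_powr_ge) simp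
  finally show "ln (real n) \<le> weight_sum n 1" by (simp add: box_cox_def weight_sum_def)
  show "weight_sum n 1 \<le> 2 * ln (real n)"
    unfolding weight_sum_def using sum_inverse_le[of n] ln_ge_1[OF n] n by linarith
qed

text \<open>
  The weight sum is of the order of \<open>n powr (1 - \<beta>)\<close> for \<open>\<beta> < 1\<close> and bounded for \<open>\<beta> > 1\<close>; in both
  cases one of the two summands of \<open>D\<close> has the right order and dominates the other.
\<close>
lemma weight_sum_powr_bounds:
  assumes n: "n \<ge> 1" and \<beta>: "0 \<le> \<beta>" "\<beta> \<noteq> 1" and \<eta>: "0 \<le> \<eta>"
  defines "D \<equiv> 1 + real n powr ((1 - \<beta>) * \<eta>)"
  shows "D / 2 \<le> weight_sum n \<beta> powr \<eta>"
    and "weight_sum n \<beta> powr \<eta> \<le> (1 + 1 / \<bar>1 - \<beta>\<bar>) powr \<eta> * D"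
proof -
  let ?B = "weight_sum n \<beta>" and ?K = "1 + 1 / \<bar>1 - \<beta>\<bar>"
  have B: "1 \<le> ?B" by (rule weight_sum_ge_1[OF n])
  have "D / 2 \<le> ?B powr \<eta> \<and> ?B powr \<eta> \<le> ?K powr \<eta> * D"
  proof (cases "\<beta> < 1")
    case True
    have "(real n powr (1 - \<beta>)) powr \<eta> \<le> ?B powr \<eta>"
      using weight_sum_bounds_less(1)[OF n \<beta>(1) True] \<eta> by (intro powr_mono2) auto
    then have 1: "real n powr ((1 - \<beta>) * \<eta>) \<le> ?B powr \<eta>" by (simp add: powr_powr)
    have "1 \<le> real n powr ((1 - \<beta>) * \<eta>)" using n True \<eta> by (intro ge_one_powr_ge_zero) auto
    then have 2: "D / 2 \<le> ?B powr \<eta>" using 1 by (simp add: D_def)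
    have "?B \<le> real n powr (1 - \<beta>) * (1 / (1 - \<beta>))" using weight_sum_bounds_less(2)[OF n \<beta>(1) True] by simp
    also have "\<dots> \<le> real n powr (1 - \<beta>) * ?K" using True by (intro mult_left_mono) auto
    finally have "?B powr \<eta> \<le> (real n powr (1 - \<beta>) * ?K) powr \<eta>" using B \<eta> by (intro powr_mono2) auto
    also have "\<dots> = ?K powr \<eta> * real n powr ((1 - \<beta>) * \<eta>)" by (simp add: powr_mult powr_powr)
    also have "\<dots> \<le> ?K powr \<eta> * D" by (intro mult_left_mono) (auto simp: D_def)
    finally show ?thesis using 2 by simp
  next
    case False
    then have b: "1 < \<beta>" using \<beta> by simp
    have "real n powr ((1 - \<beta>) * \<eta>) \<le> real n powr 0" 
      using n b \<eta> by (intro powr_mono) (auto simp: mult_nonpos_nonneg)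
    then have "D / 2 \<le> 1" using n by (simp add: D_def)
    also have "1 \<le> ?B powr \<eta>" using B \<eta> by (intro ge_one_powr_ge_zero) auto
    finally have 2: "D / 2 \<le> ?B powr \<eta>" .
    have "?B powr \<eta> \<le> ?K powr \<eta> * 1" using weight_sum_le_greater[OF n b] b B \<eta> by (simp add: powr_mono2)
    also have "\<dots> \<le> ?K powr \<eta> * D" by (intro mult_left_mono) (auto simp: D_def)
    finally show ?thesis using 2 by simp
  qed
  then show "D / 2 \<le> ?B powr \<eta>" "?B powr \<eta> \<le> ?K powr \<eta> * D" by auto
qed

section \<open>Tail bounds in terms of the dimension\<close>

text \<open>
  The condition \<open>p \<noteq> 2 - 2 * r\<close> says \<open>\<beta> \<noteq> 1\<close>, so that the weight sum is a power of \<open>n\<close> or bounded.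
\<close>
lemma prob_rearr_sum_bounds_noncritical:
  fixes M :: "'a measure" and X :: "nat \<Rightarrow> 'a \<Rightarrow> real"
  assumes N: "std_normal_vector M n X" and n: "n \<ge> 3" and p: "1 < p" "p < 3 / 2" and r: "0 \<le> r"
    and ne: "p \<noteq> 2 - 2 * r"
    and t: "t > 2 * weight_sum n (2 * r / (2 - p)) powr (2 - p) * (8 * real n) powr (p - 1)"
  defines "K \<equiv> (1 + 1 / \<bar>1 - 2 * r / (2 - p)\<bar>) powr ((2 - p) / (p - 1))"
    and "D \<equiv> 1 + real n powr ((2 - 2 * r - p) / (p - 1))"
  shows "measure M {\<omega> \<in> space M. rearr_sum n r p (\<lambda>i. X i \<omega>) > t}
      \<le> 2 * exp (- ((1 / 2) powr (1 / (p - 1)) / (8 * K)) * inverse D * t powr (1 / (p - 1)))"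
    and "measure M {\<omega> \<in> space M. rearr_sum n r p (\<lambda>i. X i \<omega>) > t}
      \<ge> 2 * exp (- 8 * inverse D * t powr (1 / (p - 1)))"
proof -
  define \<beta> where "\<beta> = 2 * r / (2 - p)"
  define \<gamma> where "\<gamma> = 1 / (p - 1)"
  define B where "B = weight_sum n \<beta>"
  define G where "G = B powr ((2 - p) * \<gamma>)"
  have \<beta>: "0 \<le> \<beta>" "\<beta> \<noteq> 1" using p r ne by (auto simp: \<beta>_def field_simps)
  have \<gamma>: "0 < \<gamma>" using p by (simp add: \<gamma>_def)
  have B: "1 \<le> B" unfolding B_def using n by (intro weight_sum_ge_1) auto
  have G0: "0 < G" using B by (simp add: G_def)
  have "0 < 1 + 1 / \<bar>1 - 2 * r / (2 - p)\<bar>" by (intro add_pos_nonneg) auto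
  then have K0: "0 < K" unfolding K_def by (simp only: powr_gt_zero)
  have D0: "0 < D" unfolding D_def by (simp add: add_pos_nonneg)
  have t0: "0 < t" by (rule le_less_trans[OF _ t]) auto
  have "1 - \<beta> = (2 - 2 * r - p) / (2 - p)"
    using p by (simp add: \<beta>_def diff_divide_distrib[symmetric] divide_simps)
  then have "(1 - \<beta>) * ((2 - p) * \<gamma>) = (2 - 2 * r - p) / (p - 1)"
    using p by (simp add: \<gamma>_def)
  then have G: "D / 2 \<le> G" "G \<le> K * D"
    using weight_sum_powr_bounds[of n \<beta> "(2 - p) * \<gamma>"] n \<beta> \<gamma> p
    by (auto simp: D_def G_def B_def K_def \<beta>_def \<gamma>_def)
  have Z: "(t / B powr (2 - p)) powr \<gamma> = t powr \<gamma> / G"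
    using t0 by (simp add: powr_divide powr_powr G_def)
  have n1: "n \<ge> 1" and p2: "p < 2" using n p by auto
  note main = prob_rearr_sum_greater_bounds[OF N n1 p(1) p2 r t, folded \<beta>_def \<gamma>_def, folded B_def, unfolded Z]
  have "1 / (K * D) \<le> 1 / G" using G G0 by (intro divide_left_mono) (auto simp: K0 D0)
  then have "((1 / 2) powr \<gamma> / 8 * t powr \<gamma>) * (1 / (K * D)) \<le> ((1 / 2) powr \<gamma> / 8 * t powr \<gamma>) * (1 / G)"
    by (intro mult_left_mono) auto
  then have "2 * exp (- (((1 / 2) powr \<gamma> / 8) * (t powr \<gamma> / G)))
      \<le> 2 * exp (- ((1 / 2) powr \<gamma> / (8 * K)) * inverse D * t powr \<gamma>)"
    by (simp add: field_simps)
  then show "measure M {\<omega> \<in> space M. rearr_sum n r p (\<lambda>i. X i \<omega>) > t}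
      \<le> 2 * exp (- ((1 / 2) powr (1 / (p - 1)) / (8 * K)) * inverse D * t powr (1 / (p - 1)))"
    using main(1) unfolding \<gamma>_def by linarith
  have "1 / G \<le> 1 / (D / 2)" using G D0 G0 by (intro divide_left_mono) auto
  then have "4 * t powr \<gamma> * (1 / G) \<le> 4 * t powr \<gamma> * (1 / (D / 2))"
    by (intro mult_left_mono) auto
  then have "2 * exp (- 8 * inverse D * t powr \<gamma>) \<le> 2 * exp (- (4 * (t powr \<gamma> / G)))"
    by (simp add: field_simps)
  then show "measure M {\<omega> \<in> space M. rearr_sum n r p (\<lambda>i. X i \<omega>) > t}
      \<ge> 2 * exp (- 8 * inverse D * t powr (1 / (p - 1)))"
    using main(2) unfolding \<gamma>_def by linarith
qed

text \<open>
  Here \<open>\<beta> = 1\<close> and the weight sum is harmonic. Constants outside the power \<open>\<gamma>\<close> become universal inside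
  it: \<open>4 = (4 powr (p - 1)) powr \<gamma>\<close> with \<open>4 powr (p - 1) \<le> 4\<close>, and likewise
  \<open>2 * 8 powr (p - 1) * 2 powr (2 - p) \<le> 32\<close>.
\<close>
lemma prob_rearr_sum_bounds_critical:
  fixes M :: "'a measure" and X :: "nat \<Rightarrow> 'a \<Rightarrow> real"
  assumes N: "std_normal_vector M n X" and n: "n \<ge> 3" and p: "1 < p" "p < 3 / 2" and r: "0 \<le> r"
    and eq: "p = 2 - 2 * r"
    and t: "t > 2 * weight_sum n (2 * r / (2 - p)) powr (2 - p) * (8 * real n) powr (p - 1)"
  shows "measure M {\<omega> \<in> space M. rearr_sum n r p (\<lambda>i. X i \<omega>) > t}
      \<le> 2 * exp (- (ln (real n) powr (- ((2 - p) / (p - 1)))) * (1 / 32 * t) powr (1 / (p - 1)))"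
    and "measure M {\<omega> \<in> space M. rearr_sum n r p (\<lambda>i. X i \<omega>) > t}
      \<ge> 2 * exp (- (ln (real n) powr (- ((2 - p) / (p - 1)))) * (4 * t) powr (1 / (p - 1)))"
proof -
  define \<gamma> where "\<gamma> = 1 / (p - 1)"
  define B where "B = weight_sum n 1"
  define L where "L = ln (real n)"
  have \<beta>: "2 * r / (2 - p) = 1" using p eq by (simp add: field_simps)
  have \<gamma>: "0 < \<gamma>" "(p - 1) * \<gamma> = 1" using p by (auto simp: \<gamma>_def)
  have L: "1 \<le> L" unfolding L_def by (rule ln_ge_1[OF n])
  have B: "L \<le> B" "B \<le> 2 * L" unfolding B_def L_def by (rule weight_sum_bounds_1[OF n])+
  have t0: "0 < t" by (rule le_less_trans[OF _ t]) auto
  have n1: "n \<ge> 1" and p2: "p < 2" using n p by auto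
  note main = prob_rearr_sum_greater_bounds[OF N n1 p(1) p2 r t, unfolded \<beta>, folded B_def \<gamma>_def]
  have L\<gamma>: "(y / L powr (2 - p)) powr \<gamma> = L powr (- ((2 - p) * \<gamma>)) * y powr \<gamma>" if "0 \<le> y" for y
    using that L by (subst powr_divide) (auto simp: powr_powr powr_minus_divide simp del: powr_minus)
  have c8: "8 powr (p - 1) \<le> (8 :: real)" using powr_mono[of "p - 1" 1 "8 :: real"] p by simp
  have c2: "2 powr (2 - p) \<le> (2 :: real)" using powr_mono[of "2 - p" 1 "2 :: real"] p by simp
  have "B powr (2 - p) \<le> (2 * L) powr (2 - p)" using B L p by (intro powr_mono2) auto
  also have "\<dots> = 2 powr (2 - p) * L powr (2 - p)" using L by (simp add: powr_mult)
  also have "\<dots> \<le> 2 * L powr (2 - p)" using c2 by (intro mult_right_mono) auto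
  finally have BL: "B powr (2 - p) \<le> 2 * L powr (2 - p)" .
  have "2 * 8 powr (p - 1) * B powr (2 - p) \<le> 2 * 8 * (2 * L powr (2 - p))"
    using c8 BL by (intro mult_mono) auto
  then have "t / (32 * L powr (2 - p)) \<le> t / (2 * 8 powr (p - 1) * B powr (2 - p))"
    using t0 B L by (intro divide_left_mono) auto
  then have "(t / (32 * L powr (2 - p))) powr \<gamma> \<le> (t / (2 * 8 powr (p - 1) * B powr (2 - p))) powr \<gamma>"
    using t0 \<gamma> by (intro powr_mono2) auto
  moreover have "(t / (32 * L powr (2 - p))) powr \<gamma> = L powr (- ((2 - p) * \<gamma>)) * (1 / 32 * t) powr \<gamma>"
    using L\<gamma>[of "1 / 32 * t"] t0 by simp
  moreover have "(t / (2 * 8 powr (p - 1) * B powr (2 - p))) powr \<gamma> = (1 / 2) powr \<gamma> / 8 * (t / B powr (2 - p)) powr \<gamma>"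
  proof -
    have "(8 powr (p - 1)) powr \<gamma> = (8 :: real)" using \<gamma> by (simp add: powr_powr)
    then show ?thesis using t0 by (simp add: powr_divide powr_mult)
  qed
  ultimately have "2 * exp (- (((1 / 2) powr \<gamma> / 8) * (t / B powr (2 - p)) powr \<gamma>))
      \<le> 2 * exp (- (L powr (- ((2 - p) * \<gamma>)) * (1 / 32 * t) powr \<gamma>))" by simp
  note order_trans[OF main(1) this]
  then show "measure M {\<omega> \<in> space M. rearr_sum n r p (\<lambda>i. X i \<omega>) > t}
      \<le> 2 * exp (- (ln (real n) powr (- ((2 - p) / (p - 1)))) * (1 / 32 * t) powr (1 / (p - 1)))"
    by (simp add: \<gamma>_def L_def)
  have "L powr (2 - p) \<le> B powr (2 - p)" using B L p by (intro powr_mono2) auto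
  then have "(4 powr (p - 1) * t) / B powr (2 - p) \<le> (4 * t) / L powr (2 - p)"
    using t0 L B p powr_mono[of "p - 1" 1 "4 :: real"] by (intro frac_le mult_right_mono) auto
  then have "((4 powr (p - 1) * t) / B powr (2 - p)) powr \<gamma> \<le> ((4 * t) / L powr (2 - p)) powr \<gamma>"
    using t0 \<gamma> by (intro powr_mono2) auto
  moreover have "((4 powr (p - 1) * t) / B powr (2 - p)) powr \<gamma> = 4 * (t / B powr (2 - p)) powr \<gamma>"
  proof -
    have "(4 powr (p - 1)) powr \<gamma> = (4 :: real)" using \<gamma> by (simp add: powr_powr)
    then show ?thesis using t0 by (simp add: powr_divide powr_mult)
  qed
  moreover have "((4 * t) / L powr (2 - p)) powr \<gamma> = L powr (- ((2 - p) * \<gamma>)) * (4 * t) powr \<gamma>"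
    using t0 by (intro L\<gamma>) auto
  ultimately have "2 * exp (- (L powr (- ((2 - p) * \<gamma>)) * (4 * t) powr \<gamma>))
      \<le> 2 * exp (- (4 * (t / B powr (2 - p)) powr \<gamma>))" by simp
  note order_trans[OF this main(2)]
  then show "measure M {\<omega> \<in> space M. rearr_sum n r p (\<lambda>i. X i \<omega>) > t}
      \<ge> 2 * exp (- (ln (real n) powr (- ((2 - p) / (p - 1)))) * (4 * t) powr (1 / (p - 1)))"
    by (simp add: \<gamma>_def L_def)
qed

theorem mainTheorem2:
  shows
    "(\<exists>c C :: real. c > 0 \<and> C > 0 \<and>
       (\<forall>(n::nat) (p::real) (r::real) (M::'a measure) (X :: nat \<Rightarrow> 'a \<Rightarrow> real) (m::real).
          n \<ge> 3 \<longrightarrow> 1 < p \<longrightarrow> p < 3 / 2 \<longrightarrow> 0 \<le> r \<longrightarrow> r \<le> 2 \<longrightarrow>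
          std_normal_vector M n X \<longrightarrow>
          is_median M (\<lambda>\<omega>. rearr_sum n r p (\<lambda>i. X i \<omega>)) m \<longrightarrow>
          (r \<le> 1 / 2 \<longrightarrow>
             m \<le> C * real n powr (1 - 2 * r) * ln (real n) powr p
                   * (1 + (1 - 2 * r) * ln (real n)) powr (- p) \<and>
             m \<ge> c * real n powr (1 - 2 * r) * ln (real n) powr p
                   * (1 + (1 - 2 * r) * ln (real n)) powr (- p)) \<and>
          (1 / 2 \<le> r \<longrightarrow>
             m \<le> C * ln (real n) powr p * inverse (1 + (2 * r - 1) * ln (real n)) \<and>
             m \<ge> c * ln (real n) powr p * inverse (1 + (2 * r - 1) * ln (real n)))))
     \<and>
     (\<exists>c C :: real. c > 0 \<and> C > 0 \<and>
       (\<forall>(p::real) (r::real). 1 < p \<longrightarrow> p < 3 / 2 \<longrightarrow> 0 \<le> r \<longrightarrow> r \<le> 2 \<longrightarrow>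
         (\<exists>crp Crp nrp :: real. crp > 0 \<and> Crp > 0 \<and> nrp > 0 \<and>
           (\<forall>n::nat. n \<ge> 3 \<longrightarrow>
             (\<exists>t0::real. t0 > 0 \<and>
               (\<forall>(M::'a measure) (X :: nat \<Rightarrow> 'a \<Rightarrow> real) (t::real).
                 std_normal_vector M n X \<longrightarrow> t > t0 \<longrightarrow>
                 (p \<noteq> 2 - 2 * r \<longrightarrow> real n > nrp \<longrightarrow>
                    measure M {\<omega> \<in> space M. rearr_sum n r p (\<lambda>i. X i \<omega>) > t}
                      \<le> 2 * exp (- crp * inverse (1 + real n powr ((2 - 2 * r - p) / (p - 1)))
                                   * t powr (1 / (p - 1))) \<and>
                    measure M {\<omega> \<in> space M. rearr_sum n r p (\<lambda>i. X i \<omega>) > t}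
                      \<ge> 2 * exp (- Crp * inverse (1 + real n powr ((2 - 2 * r - p) / (p - 1)))
                                   * t powr (1 / (p - 1)))) \<and>
                 (p = 2 - 2 * r \<longrightarrow>
                    measure M {\<omega> \<in> space M. rearr_sum n r p (\<lambda>i. X i \<omega>) > t}
                      \<le> 2 * exp (- (ln (real n) powr (- ((2 - p) / (p - 1))))
                                   * (c * t) powr (1 / (p - 1))) \<and>
                    measure M {\<omega> \<in> space M. rearr_sum n r p (\<lambda>i. X i \<omega>) > t}
                      \<ge> 2 * exp (- (ln (real n) powr (- ((2 - p) / (p - 1))))
                                   * (C * t) powr (1 / (p - 1))))))))))"
proof (rule conjI, goal_cases)
  case 1
  show ?case
    by (rule exI[of _ "exp (- 16) / 512"], rule exI[of _ 448], intro conjI allI impI)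
      (simp_all only: median_rearr_sum_bounds, simp_all)
next
  case 2
  show ?case
  proof (rule exI[of _ "1 / 32"], rule exI[of _ 4], intro conjI allI impI)
    fix p r :: real
    assume p: "1 < p" "p < 3 / 2" and r: "0 \<le> r" "r \<le> 2"
    define K where "K = (1 + 1 / \<bar>1 - 2 * r / (2 - p)\<bar>) powr ((2 - p) / (p - 1))"
    have "0 < 1 + 1 / \<bar>1 - 2 * r / (2 - p)\<bar>" by (intro add_pos_nonneg) auto
    then have K: "0 < K" unfolding K_def by (simp only: powr_gt_zero)
    show "\<exists>crp Crp nrp :: real. crp > 0 \<and> Crp > 0 \<and> nrp > 0 \<and>
           (\<forall>n::nat. n \<ge> 3 \<longrightarrow>
             (\<exists>t0::real. t0 > 0 \<and>
               (\<forall>(M::'a measure) (X :: nat \<Rightarrow> 'a \<Rightarrow> real) (t::real).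
                 std_normal_vector M n X \<longrightarrow> t > t0 \<longrightarrow>
                 (p \<noteq> 2 - 2 * r \<longrightarrow> real n > nrp \<longrightarrow>
                    measure M {\<omega> \<in> space M. rearr_sum n r p (\<lambda>i. X i \<omega>) > t}
                      \<le> 2 * exp (- crp * inverse (1 + real n powr ((2 - 2 * r - p) / (p - 1)))
                                   * t powr (1 / (p - 1))) \<and>
                    measure M {\<omega> \<in> space M. rearr_sum n r p (\<lambda>i. X i \<omega>) > t}
                      \<ge> 2 * exp (- Crp * inverse (1 + real n powr ((2 - 2 * r - p) / (p - 1)))
                                   * t powr (1 / (p - 1)))) \<and>
                 (p = 2 - 2 * r \<longrightarrow>
                    measure M {\<omega> \<in> space M. rearr_sum n r p (\<lambda>i. X i \<omega>) > t}
                      \<le> 2 * exp (- (ln (real n) powr (- ((2 - p) / (p - 1))))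
                                   * (1 / 32 * t) powr (1 / (p - 1))) \<and>
                    measure M {\<omega> \<in> space M. rearr_sum n r p (\<lambda>i. X i \<omega>) > t}
                      \<ge> 2 * exp (- (ln (real n) powr (- ((2 - p) / (p - 1))))
                                   * (4 * t) powr (1 / (p - 1))))))) "
    proof (rule exI[of _ "(1 / 2) powr (1 / (p - 1)) / (8 * K)"], rule exI[of _ 8], rule exI[of _ 1],
        intro conjI allI impI)
      show "0 < (1 / 2) powr (1 / (p - 1)) / (8 * K)" using K by simp
      fix n :: nat assume n: "n \<ge> 3"
      let ?t0 = "2 * weight_sum n (2 * r / (2 - p)) powr (2 - p) * (8 * real n) powr (p - 1)"
      have "1 \<le> weight_sum n (2 * r / (2 - p))" using n by (intro weight_sum_ge_1) auto
      then have t0: "?t0 > 0" using n by simp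
      note generic = prob_rearr_sum_bounds_noncritical[OF _ n p r(1), folded K_def]
        and critical = prob_rearr_sum_bounds_critical[OF _ n p r(1)]
      show "\<exists>t0::real. t0 > 0 \<and>
               (\<forall>(M::'a measure) (X :: nat \<Rightarrow> 'a \<Rightarrow> real) (t::real).
                 std_normal_vector M n X \<longrightarrow> t > t0 \<longrightarrow>
                 (p \<noteq> 2 - 2 * r \<longrightarrow> real n > 1 \<longrightarrow>
                    measure M {\<omega> \<in> space M. rearr_sum n r p (\<lambda>i. X i \<omega>) > t}
                      \<le> 2 * exp (- ((1 / 2) powr (1 / (p - 1)) / (8 * K)) * inverse (1 + real n powr ((2 - 2 * r - p) / (p - 1)))
                                   * t powr (1 / (p - 1))) \<and>
                    measure M {\<omega> \<in> space M. rearr_sum n r p (\<lambda>i. X i \<omega>) > t}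
                      \<ge> 2 * exp (- 8 * inverse (1 + real n powr ((2 - 2 * r - p) / (p - 1)))
                                   * t powr (1 / (p - 1)))) \<and>
                 (p = 2 - 2 * r \<longrightarrow>
                    measure M {\<omega> \<in> space M. rearr_sum n r p (\<lambda>i. X i \<omega>) > t}
                      \<le> 2 * exp (- (ln (real n) powr (- ((2 - p) / (p - 1))))
                                   * (1 / 32 * t) powr (1 / (p - 1))) \<and>
                    measure M {\<omega> \<in> space M. rearr_sum n r p (\<lambda>i. X i \<omega>) > t}
                      \<ge> 2 * exp (- (ln (real n) powr (- ((2 - p) / (p - 1))))
                                   * (4 * t) powr (1 / (p - 1)))))"
        by (rule exI[of _ ?t0], intro conjI allI impI t0)
          (erule (2) generic critical)+
    qed simp_all
  qed simp_all
qed

end
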